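(* Let $\sigma_0\in C^2(\mathbb{R}^n;\mathbb{R}^n)$, let $\sigma=(\sigma_1,\dots,\sigma_m):\mathbb{R}^n\to\mathbb{R}^{n\times m}$ be of class $C^2$ and let $u:\mathbb{R}^n\to\mathbb{R}$ be of class $C^3$. Let $\bar x\in\mathbb{R}^n$ be a point such that $\nabla u(\bar x)\ne0$ and $\nabla u(\bar x)\cdot\sigma_i(\bar x)=0$ for $i=0,1,\dots,m$. Suppose moreover that $$\nabla(\nabla u\cdot\sigma_0)\cdot\sigma_0(\bar x)\le0$$ and that either there is $j\in\{1,\dots,m\}$ such that $[\sigma_0,\sigma_j](\bar x)\cdot\nabla u(\bar x)\ne0$, or $K(\bar x)$ is not positive semidefinite. Then the target $\mathcal T=\{x:u(x)\le u(\bar x)\}$ is STLA at $\bar x$ for the nonlinear affine system $\dot x_t=\sigma_0(x_t)+\sigma(x_t)a_t$ with controls valued in $B_1(0)=\{a\in\mathbb{R}^m:|a|\le1\}$, and there are $C,r>0$ such that the minimum time function satisfies $T(x)\le C|x-\bar x|^{1/2}$ whenever $|x-\bar x|\le r$.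
   Context: Controls $a_\cdot:[0,+\infty)\to B_1(0)$ are piecewise constant (finitely many pieces on bounded intervals); trajectories are solutions of the system on their maximal interval of existence. Minimum time function: $T(x)=\inf_{a_\cdot}t_x(a_\cdot)$, $t_x(a_\cdot)=\inf\{t\ge0:x_t\in\mathcal T\}$ with $x_0=x$ ($\inf\emptyset=+\infty$). $\mathcal T$ is small time locally attainable (STLA) at $\bar x$ if for every $t>0$ the point $\bar x$ is interior to the set of points from which $\mathcal T$ can be reached in time less than $t$ along trajectories of the system (equivalently, $T$ is continuous at $\bar x$). Lie bracket: $[f,g]=Dg\,f-Df\,g$, with $Df=(\partial_{x_j}f_i)_{i,j}$ the Jacobian. The matrix $K$ is built from $\sigma$ only (not from the drift $\sigma_0$): let $S(x)$ be the $m\times m$ matrix with entries $S_{i,j}(x)=\nabla(\nabla u\cdot\sigma_i)(x)\cdot\sigma_j(x)$, $i,j=1,\dots,m$, let $S^*=\frac12(S+{}^tS)$ and $$K(x)=\begin{pmatrix}S^*(x)&{}^tS(x)\\S(x)&S^*(x)\end{pmatrix}.$$ *)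

theory Defs
  imports "HOL-Analysis.Analysis"
begin

section \<open>Differential calculus\<close>

text \<open>Class \<open>C\<^sup>k\<close> on the whole space: all partial derivatives up to order \<open>k\<close> exist and are continuous.
  The gradient and the Jacobian below are built from \<^const>\<open>frechet_derivative\<close>, which is meaningful
  only at points of differentiability.\<close>

primrec class_C :: "nat \<Rightarrow> ('a::euclidean_space \<Rightarrow> 'b::real_normed_vector) \<Rightarrow> bool" where
  "class_C 0 f \<longleftrightarrow> continuous_on UNIV f"
| "class_C (Suc k) f \<longleftrightarrow>
     (\<forall>x. f differentiable (at x)) \<and>
     (\<forall>b\<in>Basis. class_C k (\<lambda>x. frechet_derivative f (at x) b))"

definition grad :: "(real^'n \<Rightarrow> real) \<Rightarrow> real^'n \<Rightarrow> real^'n" where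
  "grad u x = (\<chi> i. frechet_derivative u (at x) (axis i 1))"

definition lie_bracket :: "(real^'n \<Rightarrow> real^'n) \<Rightarrow> (real^'n \<Rightarrow> real^'n) \<Rightarrow> real^'n \<Rightarrow> real^'n" where
  "lie_bracket f g x = jacobian g (at x) *v f x - jacobian f (at x) *v g x"

section \<open>Control systems\<close>

definition piecewise_constant :: "(real \<Rightarrow> 'a) \<Rightarrow> bool" where
  "piecewise_constant a \<longleftrightarrow>
     (\<forall>R\<ge>0. \<exists>P. finite P \<and> \<Union>P = {0..R} \<and> (\<forall>J\<in>P. is_interval J \<and> a constant_on J))"

text \<open>Controls are total functions of which only the restriction to nonnegative times matters.\<close>

definition controls :: "(real \<Rightarrow> 'a::real_normed_vector) set" where
  "controls = {a. piecewise_constant a \<and> (\<forall>t\<ge>0. a t \<in> cball 0 1)}"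

text \<open>Solutions of \<open>y' = F y a\<close> on \<open>[0,\<tau>)\<close>, \<open>\<tau> \<in> (0,\<infinity>]\<close>, starting at \<open>x\<close>: \<open>y\<close> is continuous, and the
  equation holds at every time around which the control is constant, i.e. away from the switching
  times. Values of \<open>y\<close> outside \<open>[0,\<tau>)\<close> are irrelevant.\<close>

definition solution_on ::
  "('x::real_normed_vector \<Rightarrow> 'a \<Rightarrow> 'x) \<Rightarrow> (real \<Rightarrow> 'a) \<Rightarrow> 'x \<Rightarrow> ereal \<Rightarrow> (real \<Rightarrow> 'x) \<Rightarrow> bool" where
  "solution_on F a x \<tau> y \<longleftrightarrow>
     0 < \<tau> \<and> y 0 = x \<and> continuous_on {t. 0 \<le> t \<and> ereal t < \<tau>} y \<and>
     (\<forall>t. 0 < t \<and> ereal t < \<tau> \<and> (\<forall>\<^sub>F s in nhds t. a s = a t) \<longrightarrow>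
        (y has_vector_derivative F (y t) (a t)) (at t))"

text \<open>A trajectory is a solution on its maximal interval of existence.\<close>

definition trajectory ::
  "('x::real_normed_vector \<Rightarrow> 'a \<Rightarrow> 'x) \<Rightarrow> (real \<Rightarrow> 'a) \<Rightarrow> 'x \<Rightarrow> ereal \<Rightarrow> (real \<Rightarrow> 'x) \<Rightarrow> bool" where
  "trajectory F a x \<tau> y \<longleftrightarrow>
     solution_on F a x \<tau> y \<and>
     (\<forall>\<tau>' y'. solution_on F a x \<tau>' y' \<and> (\<forall>t. 0 \<le> t \<and> ereal t < \<tau> \<longrightarrow> y' t = y t) \<longrightarrow> \<tau>' \<le> \<tau>)"

definition hitting_times ::
  "('x::real_normed_vector \<Rightarrow> 'a \<Rightarrow> 'x) \<Rightarrow> 'x set \<Rightarrow> (real \<Rightarrow> 'a) \<Rightarrow> 'x \<Rightarrow> real set" where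
  "hitting_times F \<T> a x =
     {t. \<exists>\<tau> y. trajectory F a x \<tau> y \<and> 0 \<le> t \<and> ereal t < \<tau> \<and> y t \<in> \<T>}"

text \<open>In \<^typ>\<open>ereal\<close> the infimum of the empty set is \<open>\<infinity>\<close>.\<close>

definition hitting_time ::
  "('x::real_normed_vector \<Rightarrow> 'a \<Rightarrow> 'x) \<Rightarrow> 'x set \<Rightarrow> (real \<Rightarrow> 'a) \<Rightarrow> 'x \<Rightarrow> ereal" where
  "hitting_time F \<T> a x = (INF t\<in>hitting_times F \<T> a x. ereal t)"

definition min_time ::
  "('x::real_normed_vector \<Rightarrow> 'a::real_normed_vector \<Rightarrow> 'x) \<Rightarrow> 'x set \<Rightarrow> 'x \<Rightarrow> ereal" where
  "min_time F \<T> x = (INF a\<in>controls. hitting_time F \<T> a x)"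

definition STLA ::
  "('x::real_normed_vector \<Rightarrow> 'a::real_normed_vector \<Rightarrow> 'x) \<Rightarrow> 'x set \<Rightarrow> 'x \<Rightarrow> bool" where
  "STLA F \<T> p \<longleftrightarrow>
     (\<forall>t>0. p \<in> interior {x. \<exists>a\<in>controls. \<exists>s\<in>hitting_times F \<T> a x. s < t})"

definition affine_system ::
  "(real^'n \<Rightarrow> real^'n) \<Rightarrow> (real^'n \<Rightarrow> real^'m^'n) \<Rightarrow> real^'n \<Rightarrow> real^'m \<Rightarrow> real^'n" where
  "affine_system \<sigma>0 \<sigma> x a = \<sigma>0 x + \<sigma> x *v a"

section \<open>The matrix \<open>K\<close>\<close>

text \<open>The fields \<open>\<sigma>\<^sub>1, \<dots>, \<sigma>\<^sub>m\<close> are the columns of the matrix field \<open>\<sigma>\<close>.\<close>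

definition S_mat :: "(real^'n \<Rightarrow> real) \<Rightarrow> (real^'n \<Rightarrow> real^'m^'n) \<Rightarrow> real^'n \<Rightarrow> real^'m^'m" where
  "S_mat u \<sigma> x = (\<chi> i j. grad (\<lambda>z. grad u z \<bullet> column i (\<sigma> z)) x \<bullet> column j (\<sigma> x))"

definition sym_part :: "real^'m^'m \<Rightarrow> real^'m^'m" where
  "sym_part A = (1/2) *\<^sub>R (A + transpose A)"

definition block_matrix ::
  "real^'m^'m \<Rightarrow> real^'m^'m \<Rightarrow> real^'m^'m \<Rightarrow> real^'m^'m \<Rightarrow> real^('m + 'm)^('m + 'm)" where
  "block_matrix A B C D = (\<chi> p q.
     case p of
       Inl i \<Rightarrow> (case q of Inl j \<Rightarrow> A $ i $ j | Inr j \<Rightarrow> B $ i $ j)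
     | Inr i \<Rightarrow> (case q of Inl j \<Rightarrow> C $ i $ j | Inr j \<Rightarrow> D $ i $ j))"

definition K_mat ::
  "(real^'n \<Rightarrow> real) \<Rightarrow> (real^'n \<Rightarrow> real^'m^'n) \<Rightarrow> real^'n \<Rightarrow> real^('m + 'm)^('m + 'm)" where
  "K_mat u \<sigma> x =
     (let S = S_mat u \<sigma> x
      in block_matrix (sym_part S) (transpose S) S (sym_part S))"

text \<open>Only used for \<open>K\<close>, which is symmetric.\<close>

definition pos_semidef :: "real^'k^'k \<Rightarrow> bool" where
  "pos_semidef A \<longleftrightarrow> (\<forall>v. 0 \<le> v \<bullet> (A *v v))"

lemma transpose_K_mat: "transpose (K_mat u \<sigma> x) = K_mat u \<sigma> x"
  by (auto simp: K_mat_def Let_def block_matrix_def sym_part_def transpose_def vec_eq_iff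
      split: sum.splits)

end

theory Submission
  imports Defs
begin

text \<open>
  Write \<open>L\<^sub>a u = \<nabla>u \<bullet> (\<sigma>\<^sub>0 + \<sigma> a)\<close> for the derivative of \<open>u\<close> along the vector field of a constant control \<open>a\<close>.
  Using \<open>a\<close> for a time \<open>t\<close> and then \<open>b\<close> for a time \<open>t\<close> changes \<open>u\<close>, up to \<open>o(t\<^sup>2)\<close>, by
  \<open>t (L\<^sub>a u + L\<^sub>b u) + t\<^sup>2/2 Q(a,b)\<close> with \<open>Q(a,b) = L\<^sub>a L\<^sub>a u + 2 L\<^sub>a L\<^sub>b u + L\<^sub>b L\<^sub>b u\<close>. At the
  base point the first-order terms vanish, because every field is tangent to the level set of \<open>u\<close>.
  Hence everything rests on finding controls in the unit ball with \<open>Q(a,b) < 0\<close> there.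

  Expanding in the fields \<open>\<sigma>\<^sub>0, \<dots>, \<sigma>\<^sub>m\<close> gives
  \<open>Q(a,b) = 4c + (p + 3q) \<bullet> a + (3p + q) \<bullet> b + (a,b) \<bullet> K (a,b)\<close>, where \<open>c = L\<^sub>0 L\<^sub>0 u \<le> 0\<close>,
  \<open>p\<^sub>j = L\<^sub>0 L\<^sub>j u\<close> and \<open>q\<^sub>j = L\<^sub>j L\<^sub>0 u\<close> (\<open>second_lie_deriv_affine_system\<close>). The linear part vanishes
  only if \<open>p = q = 0\<close>, while \<open>p\<^sub>j - q\<^sub>j = [\<sigma>\<^sub>0, \<sigma>\<^sub>j] \<bullet> \<nabla>u\<close> by the symmetry of second derivatives
  (\<open>lie_deriv_commutator\<close>). So a bracket that is not tangent lets the linear part win for small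
  controls, and a negative direction of \<open>K\<close>, whose sign can be flipped so that the linear part does
  no harm, makes \<open>Q\<close> negative otherwise (\<open>exists_negative_value\<close>).

  For \<open>x\<close> at distance \<open>\<delta>\<close> from the base point, \<open>u x\<close> exceeds the target level by at most \<open>O(\<delta>)\<close> and the
  first-order terms are \<open>O(\<delta> t)\<close>, whereas the second-order gain is a constant times \<open>t\<^sup>2\<close>. A time \<open>t\<close> of order
  \<open>\<surd>\<delta>\<close> therefore suffices (\<open>switching_reaches_sublevel\<close>), which gives both the bound on the minimum
  time and small time local attainability.

  Trajectories come from two existence results: a contraction argument yields a solution on a time
  interval independent of the starting point (\<open>local_switched_solution\<close>), and Zorn's lemma
  extends it to a maximal one (\<open>solution_on_extends_to_trajectory\<close>).
\<close>

section \<open>Functions of class \<open>C\<^sup>k\<close>\<close>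

lemma class_C_has_derivative:
  assumes "class_C (Suc k) f"
  shows "(f has_derivative frechet_derivative f (at x)) (at x)"
  using assms by (simp add: frechet_derivative_works)

text \<open>Lets any derivative found by the differentiation rules stand in for the canonical one.\<close>

lemma class_C_SucI:
  assumes "\<And>x. (f has_derivative D x) (at x)"
    and "\<And>b. b \<in> Basis \<Longrightarrow> class_C k (\<lambda>x. D x b)"
  shows "class_C (Suc k) f"
proof -
  have "frechet_derivative f (at x) = D x" for x
    using frechet_derivative_at[OF assms(1)] by simp
  with assms show ?thesis
    by (auto simp: differentiable_def)
qed

lemma class_C_Suc_imp: "class_C (Suc k) f \<Longrightarrow> class_C k f"
proof (induction k arbitrary: f)
  case 0
  then show ?case
    by (auto intro!: continuous_at_imp_continuous_on differentiable_imp_continuous_within)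
next
  case (Suc k)
  then show ?case
    by (metis class_C.simps(2))
qed

lemma class_C_mono: "m \<le> k \<Longrightarrow> class_C k f \<Longrightarrow> class_C m f"
  by (induction rule: inc_induct) (auto intro: class_C_Suc_imp simp del: class_C.simps)

lemma class_C_imp_continuous: "class_C k f \<Longrightarrow> continuous_on UNIV f"
  by (induction k) (use class_C.simps(1) class_C_Suc_imp in blast)+

lemma class_C_const: "class_C k (\<lambda>x. c)"
proof (induction k arbitrary: c)
  case (Suc k)
  show ?case by (rule class_C_SucI[where D = "\<lambda>_ _. 0"]) (auto intro: Suc)
qed simp

lemma class_C_bounded_linear:
  assumes "bounded_linear T"
  shows "class_C k f \<Longrightarrow> class_C k (\<lambda>x. T (f x))"
proof (induction k arbitrary: f)
  case 0
  then show ?case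
    using assms by (simp add: bounded_linear.continuous_on)
next
  case (Suc k)
  show ?case
    by (rule class_C_SucI[where D = "\<lambda>x v. T (frechet_derivative f (at x) v)"])
      (use Suc in \<open>auto intro!: bounded_linear.has_derivative[OF assms] simp: frechet_derivative_works\<close>)
qed

lemma class_C_add:
  "class_C k f \<Longrightarrow> class_C k g \<Longrightarrow> class_C k (\<lambda>x. f x + g x)"
proof (induction k arbitrary: f g)
  case 0
  then show ?case by (simp add: continuous_on_add)
next
  case (Suc k)
  show ?case
    by (rule class_C_SucI, rule has_derivative_add; (rule class_C_has_derivative)?)
      (use Suc in auto)
qed

lemma class_C_sum:
  "(\<And>i. i \<in> I \<Longrightarrow> class_C k (f i)) \<Longrightarrow> class_C k (\<lambda>x. \<Sum>i\<in>I. f i x)"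
  by (induction I rule: infinite_finite_induct) (auto intro: class_C_add class_C_const)

lemma class_C_bounded_bilinear:
  assumes "bounded_bilinear B"
  shows "class_C k f \<Longrightarrow> class_C k g \<Longrightarrow> class_C k (\<lambda>x. B (f x) (g x))"
proof (induction k arbitrary: f g)
  case 0
  then show ?case by (simp add: bounded_bilinear.continuous_on[OF assms])
next
  case (Suc k)
  have *: "class_C k f" "class_C k g"
    using Suc.prems by (auto intro: class_C_Suc_imp simp del: class_C.simps)
  show ?case
    by (rule class_C_SucI, rule bounded_bilinear.FDERIV[OF assms]; (rule class_C_has_derivative)?)
      (use Suc * in \<open>auto intro!: class_C_add\<close>)
qed

lemma frechet_derivative_as_sum:
  assumes "class_C (Suc k) f"
  shows "frechet_derivative f (at x) v = (\<Sum>b\<in>Basis. (v \<bullet> b) *\<^sub>R frechet_derivative f (at x) b)"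
proof -
  have l: "linear (frechet_derivative f (at x))"
    using class_C_has_derivative[OF assms] has_derivative_linear by blast
  have "frechet_derivative f (at x) v
      = frechet_derivative f (at x) (\<Sum>b\<in>Basis. (v \<bullet> b) *\<^sub>R b)"
    by (simp add: euclidean_representation)
  then show ?thesis
    by (simp add: linear_sum[OF l] linear_cmul[OF l])
qed

lemma class_C_directional_derivative:
  assumes "class_C (Suc k) f"
  shows "class_C k (\<lambda>x. frechet_derivative f (at x) v)"
  by (subst frechet_derivative_as_sum[OF assms])
    (use assms in \<open>auto intro!: class_C_sum class_C_bounded_linear[OF bounded_linear_scaleR_right]\<close>)

lemma class_C_grad:
  assumes "class_C (Suc k) u"
  shows "class_C k (grad u)"
proof -
  have "grad u = (\<lambda>x. \<Sum>i\<in>UNIV. frechet_derivative u (at x) (axis i 1) *\<^sub>R axis i 1)"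
    by (auto simp: grad_def vec_eq_iff axis_def sum.delta' if_distrib cong: if_cong)
  then show ?thesis
    using assms
    by (auto intro!: class_C_sum class_C_bounded_linear[OF bounded_linear_scaleR_left]
        class_C_directional_derivative simp del: class_C.simps)
qed

lemma inner_grad:
  assumes "class_C (Suc k) u"
  shows "grad u x \<bullet> v = frechet_derivative u (at x) v"
proof -
  have "frechet_derivative u (at x) v
      = (\<Sum>i\<in>UNIV. (v \<bullet> axis i 1) *\<^sub>R frechet_derivative u (at x) (axis i 1))"
    by (subst frechet_derivative_as_sum[OF assms])
      (simp add: Basis_vec_def sum.UNION_disjoint UNION_singleton_eq_range
        sum.reindex axis_eq_axis inj_on_def)
  moreover have "grad u x \<bullet> v = (\<Sum>i\<in>UNIV. grad u x $ i * v $ i)"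
    by (simp add: inner_vec_def)
  ultimately show ?thesis
    by (simp add: grad_def mult.commute flip: cart_eq_inner_axis)
qed

text \<open>On a compact ball the partial derivatives are bounded, hence so is the operator norm of the
  derivative; the ball is convex, so the mean value inequality applies.\<close>

lemma class_C_imp_lipschitz_on_cball:
  fixes f :: "'a::euclidean_space \<Rightarrow> 'b::real_normed_vector"
  assumes "class_C (Suc k) f"
  obtains L where "0 < L" "L-lipschitz_on (cball p \<rho>) f"
proof -
  let ?D = "\<lambda>x. frechet_derivative f (at x)"
  let ?N = "\<lambda>x. \<Sum>b\<in>Basis. norm (?D x b)"
  have "continuous_on UNIV (\<lambda>x. ?D x b)" if "b \<in> Basis" for b
    using assms that class_C_imp_continuous by auto
  then have "continuous_on (cball p \<rho>) ?N"
    by (intro continuous_intros) (auto intro: continuous_on_subset)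
  then have "bounded (?N ` cball p \<rho>)"
    by (intro compact_imp_bounded compact_continuous_image) auto
  then obtain B where B: "0 < B" "\<And>x. x \<in> cball p \<rho> \<Longrightarrow> \<bar>?N x\<bar> \<le> B"
    unfolding bounded_pos by auto
  have "norm (?D x v) \<le> B * norm v" if "x \<in> cball p \<rho>" for x v
  proof -
    have "norm (?D x v) \<le> (\<Sum>b\<in>Basis. \<bar>v \<bullet> b\<bar> * norm (?D x b))"
      by (subst frechet_derivative_as_sum[OF assms]) (auto intro!: sum_norm_le)
    also have "\<dots> \<le> (\<Sum>b\<in>Basis. norm v * norm (?D x b))"
      by (intro sum_mono mult_right_mono) (auto simp: Basis_le_norm)
    also have "\<dots> = ?N x * norm v"
      by (simp add: sum_distrib_left mult.commute)
    also have "\<dots> \<le> B * norm v"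
      using B(2)[OF that] by (intro mult_right_mono) auto
    finally show ?thesis .
  qed
  then have "norm (f x - f y) \<le> B * norm (x - y)" if "x \<in> cball p \<rho>" "y \<in> cball p \<rho>" for x y
    using that
    by (intro differentiable_bound[where S = "cball p \<rho>" and f' = ?D])
      (auto intro!: onorm_le has_derivative_at_withinI class_C_has_derivative[OF assms] simp del: mem_cball)
  then have "B-lipschitz_on (cball p \<rho>) f"
    using B(1) by (intro lipschitz_onI) (auto simp: dist_norm)
  with B(1) show thesis by (rule that)
qed

lemma class_C_has_derivative_line:
  fixes u :: "'a::euclidean_space \<Rightarrow> real"
  assumes "class_C (Suc k) u"
  shows "((\<lambda>r. u (p + r *\<^sub>R v)) has_real_derivative frechet_derivative u (at (p + r *\<^sub>R v)) v) (at r)"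
proof -
  have "((\<lambda>r. p + r *\<^sub>R v) has_vector_derivative v) (at r)"
    by (auto intro!: derivative_eq_intros simp: has_vector_derivative_def)
  from vector_derivative_diff_chain_within[OF this
      has_derivative_at_withinI[OF class_C_has_derivative[OF assms]]]
  show ?thesis
    by (simp add: o_def has_real_derivative_iff_has_vector_derivative)
qed

text \<open>The left-hand side does not change when \<open>v\<close> and \<open>w\<close> are exchanged; comparing the two resulting
  formulas proves that second derivatives commute. Each of the two steps is the mean value theorem,
  first in the direction \<open>v\<close> for the difference in the direction \<open>w\<close>, then in the direction \<open>w\<close>.\<close>

lemma second_difference_mean_value:
  fixes u :: "'a::euclidean_space \<Rightarrow> real"
  assumes "class_C 2 u" and "0 < s"
  obtains r q where "0 < r" "r < s" "0 < q" "q < s"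
    "u (p + s *\<^sub>R v + s *\<^sub>R w) - u (p + s *\<^sub>R v) - u (p + s *\<^sub>R w) + u p
      = s\<^sup>2 * frechet_derivative (\<lambda>z. frechet_derivative u (at z) v) (at (p + r *\<^sub>R v + q *\<^sub>R w)) w"
proof -
  let ?D = "\<lambda>z. frechet_derivative u (at z) v"
  have u1: "class_C (Suc 1) u"
    using assms by (simp only: Suc_1)
  have D1: "class_C (Suc 0) ?D"
    using class_C_directional_derivative[OF u1] by simp
  let ?\<phi> = "\<lambda>r. u (p + s *\<^sub>R w + r *\<^sub>R v) - u (p + r *\<^sub>R v)"
  have "\<exists>r>0. r < s \<and> ?\<phi> s - ?\<phi> 0 = (s - 0) * (?D (p + s *\<^sub>R w + r *\<^sub>R v) - ?D (p + r *\<^sub>R v))"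
    by (rule MVT2[OF assms(2)]) (auto intro!: DERIV_diff class_C_has_derivative_line[OF u1])
  then obtain r where r: "0 < r" "r < s"
    "?\<phi> s - ?\<phi> 0 = s * (?D (p + s *\<^sub>R w + r *\<^sub>R v) - ?D (p + r *\<^sub>R v))"
    by auto
  let ?\<psi> = "\<lambda>q. ?D (p + r *\<^sub>R v + q *\<^sub>R w)"
  have "\<exists>q>0. q < s \<and> ?\<psi> s - ?\<psi> 0 = (s - 0) * frechet_derivative ?D (at (p + r *\<^sub>R v + q *\<^sub>R w)) w"
    by (rule MVT2[OF assms(2)]) (auto intro!: class_C_has_derivative_line[OF D1])
  then obtain q where q: "0 < q" "q < s"
    "?\<psi> s - ?\<psi> 0 = s * frechet_derivative ?D (at (p + r *\<^sub>R v + q *\<^sub>R w)) w"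
    by auto
  have "?\<phi> s - ?\<phi> 0 = s * (s * frechet_derivative ?D (at (p + r *\<^sub>R v + q *\<^sub>R w)) w)"
    using r(3) q(3) by (simp add: algebra_simps)
  then show thesis
    by (intro that[OF r(1,2) q(1,2)]) (simp add: algebra_simps power2_eq_square)
qed

text \<open>Both mixed derivatives take a common value of the second difference quotient at points
  arbitrarily close to \<open>p\<close>, and they are continuous.\<close>

lemma second_derivative_symmetric:
  fixes u :: "'a::euclidean_space \<Rightarrow> real"
  assumes "class_C 2 u"
  shows "frechet_derivative (\<lambda>z. frechet_derivative u (at z) v) (at p) w
       = frechet_derivative (\<lambda>z. frechet_derivative u (at z) w) (at p) v"
proof (rule ccontr)
  let ?H = "\<lambda>v w z. frechet_derivative (\<lambda>z. frechet_derivative u (at z) v) (at z) w"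
  assume ne: "?H v w p \<noteq> ?H w v p"
  define e where "e = \<bar>?H v w p - ?H w v p\<bar> / 2"
  have e: "0 < e" using ne by (simp add: e_def)
  have c2: "class_C (Suc (Suc 0)) u"
    using assms by (simp only: numeral_2_eq_2)
  have cont: "continuous_on UNIV (?H v w)" for v w
    using class_C_directional_derivative[OF class_C_directional_derivative[OF c2]]
    by (metis class_C.simps(1))
  have nbhd: "\<exists>d>0. \<forall>z. dist z p < d \<longrightarrow> dist (?H v w z) (?H v w p) < e" for v w
    using cont[of v w] e unfolding continuous_on_iff by blast
  obtain d1 where d1: "0 < d1" "\<And>z. dist z p < d1 \<Longrightarrow> dist (?H v w z) (?H v w p) < e"
    using nbhd by blast
  obtain d2 where d2: "0 < d2" "\<And>z. dist z p < d2 \<Longrightarrow> dist (?H w v z) (?H w v p) < e"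
    using nbhd by blast
  \<comment> \<open>A side length for which the whole parallelogram spanned at \<open>p\<close> stays in both neighbourhoods.\<close>
  define s where "s = min d1 d2 / (norm v + norm w + 1)"
  have pos: "0 < norm v + norm w + 1"
    by (smt (verit) norm_ge_zero)
  have s: "0 < s"
    using d1(1) d2(1) pos by (simp add: s_def)
  have sd: "s * (norm v + norm w) < min d1 d2"
  proof -
    have "s * (norm v + norm w) < s * (norm v + norm w + 1)"
      using s by simp
    also have "\<dots> = min d1 d2"
      using pos by (simp add: s_def)
    finally show ?thesis .
  qed
  have close: "dist (p + r *\<^sub>R x + q *\<^sub>R y) p < min d1 d2"
    if "0 < r" "r < s" "0 < q" "q < s" "norm x + norm y = norm v + norm w" for r q x y
  proof -
    have "norm (r *\<^sub>R x + q *\<^sub>R y) \<le> r * norm x + q * norm y"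
      using that norm_triangle_ineq[of "r *\<^sub>R x" "q *\<^sub>R y"] by simp
    also have "\<dots> \<le> s * norm x + s * norm y"
      using that by (intro add_mono mult_right_mono) auto
    also have "\<dots> = s * (norm v + norm w)"
      by (simp add: distrib_left flip: that(5))
    finally show ?thesis
      using sd by (simp add: dist_norm add.assoc)
  qed
  obtain r q where rq: "0 < r" "r < s" "0 < q" "q < s"
    "u (p + s *\<^sub>R v + s *\<^sub>R w) - u (p + s *\<^sub>R v) - u (p + s *\<^sub>R w) + u p
      = s\<^sup>2 * ?H v w (p + r *\<^sub>R v + q *\<^sub>R w)"
    using second_difference_mean_value[OF assms s] by blast
  obtain r' q' where rq': "0 < r'" "r' < s" "0 < q'" "q' < s"
    "u (p + s *\<^sub>R w + s *\<^sub>R v) - u (p + s *\<^sub>R w) - u (p + s *\<^sub>R v) + u p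
      = s\<^sup>2 * ?H w v (p + r' *\<^sub>R w + q' *\<^sub>R v)"
    using second_difference_mean_value[OF assms s] by blast
  have "s\<^sup>2 * ?H v w (p + r *\<^sub>R v + q *\<^sub>R w) = s\<^sup>2 * ?H w v (p + r' *\<^sub>R w + q' *\<^sub>R v)"
    using rq(5) rq'(5) by (simp add: algebra_simps)
  then have eq: "?H v w (p + r *\<^sub>R v + q *\<^sub>R w) = ?H w v (p + r' *\<^sub>R w + q' *\<^sub>R v)"
    using s by simp
  have "dist (?H v w (p + r *\<^sub>R v + q *\<^sub>R w)) (?H v w p) < e"
    using close[OF rq(1-4), of v w] d1(2) by simp
  moreover have "dist (?H w v (p + r' *\<^sub>R w + q' *\<^sub>R v)) (?H w v p) < e"
    using close[OF rq'(1-4), of w v] d2(2) by simp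
  ultimately show False
    unfolding eq e_def dist_real_def by argo
qed

section \<open>Derivatives along vector fields\<close>

definition lie_deriv :: "(real^'n \<Rightarrow> real^'n) \<Rightarrow> (real^'n \<Rightarrow> real) \<Rightarrow> real^'n \<Rightarrow> real" where
  "lie_deriv f u x = grad u x \<bullet> f x"

lemma class_C_lie_deriv:
  assumes "class_C (Suc k) u" "class_C k f"
  shows "class_C k (lie_deriv f u)"
  unfolding lie_deriv_def
  by (intro class_C_bounded_bilinear[OF bounded_bilinear_inner] class_C_grad assms)

text \<open>The product rule; the first summand is the Hessian of \<open>u\<close> applied to \<open>g x\<close> and \<open>f x\<close>.\<close>

lemma lie_deriv_lie_deriv:
  assumes "class_C 2 u" "class_C 1 g"
  shows "lie_deriv f (lie_deriv g u) x =
    frechet_derivative (\<lambda>z. frechet_derivative u (at z) (g x)) (at x) (f x)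
    + grad u x \<bullet> frechet_derivative g (at x) (f x)"
proof -
  have u1: "class_C (Suc 1) u"
    using assms by (simp only: Suc_1)
  have g: "class_C (Suc 0) (grad u)"
    using class_C_grad[OF u1] by simp
  have "(grad u has_derivative frechet_derivative (grad u) (at x)) (at x)"
    by (rule class_C_has_derivative[OF g])
  then have "((\<lambda>z. grad u z \<bullet> w) has_derivative (\<lambda>v. frechet_derivative (grad u) (at x) v \<bullet> w)) (at x)" for w
    by (rule has_derivative_inner_left)
  then have hess: "frechet_derivative (\<lambda>z. frechet_derivative u (at z) w) (at x)
      = (\<lambda>v. frechet_derivative (grad u) (at x) v \<bullet> w)" for w
    unfolding inner_grad[OF u1] by (rule frechet_derivative_at[symmetric])
  have "(lie_deriv g u has_derivative (\<lambda>v. grad u x \<bullet> frechet_derivative g (at x) v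
      + frechet_derivative (grad u) (at x) v \<bullet> g x)) (at x)"
    unfolding lie_deriv_def[abs_def]
    using assms(2)
    by (intro has_derivative_inner class_C_has_derivative[OF g] class_C_has_derivative[of 0]) simp
  then have "frechet_derivative (lie_deriv g u) (at x) = (\<lambda>v. grad u x \<bullet> frechet_derivative g (at x) v
      + frechet_derivative (grad u) (at x) v \<bullet> g x)"
    by (rule frechet_derivative_at[symmetric])
  moreover have "class_C (Suc 0) (lie_deriv g u)"
    using class_C_lie_deriv[OF u1 assms(2)] by simp
  ultimately show ?thesis
    by (simp add: lie_deriv_def[of f] inner_grad hess del: class_C.simps)
qed

text \<open>The Hessian terms of the two iterated derivatives cancel by symmetry, which leaves the bracket.\<close>

lemma lie_deriv_commutator:
  assumes "class_C 2 u" "class_C 1 f" "class_C 1 g"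
  shows "lie_deriv f (lie_deriv g u) x - lie_deriv g (lie_deriv f u) x = lie_bracket f g x \<bullet> grad u x"
proof -
  have jac: "jacobian h (at x) *v v = frechet_derivative h (at x) v"
    if "class_C 1 h" for h :: "real^'a \<Rightarrow> real^'a" and v
  proof -
    have "linear (frechet_derivative h (at x))"
      using class_C_has_derivative[of 0 h x] has_derivative_linear that by auto
    then show ?thesis
      unfolding jacobian_def by (simp add: matrix_works flip: linear_matrix_vector_mul_eq)
  qed
  show ?thesis
    using assms second_derivative_symmetric[OF assms(1), of "g x" x "f x"]
    by (simp add: lie_deriv_lie_deriv lie_bracket_def jac
        inner_diff_left inner_diff_right inner_commute[of _ "grad u x"] del: class_C.simps)
qed

section \<open>The second-order form of an affine system\<close>

lemma bounded_linear_column: "bounded_linear (column j :: real^'m^'n \<Rightarrow> real^'n)"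
  by (auto intro!: linearI simp: column_def vec_eq_iff simp flip: linear_conv_bounded_linear)

lemma bounded_linear_mult_vec: "bounded_linear (\<lambda>A :: real^'m^'n. A *v a)"
  by (auto intro!: linearI simp: matrix_vector_mult_add_rdistrib scaleR_matrix_vector_assoc
      simp flip: linear_conv_bounded_linear)

lemma lie_deriv_affine_system:
  "lie_deriv (\<lambda>z. affine_system \<sigma>0 \<sigma> z a) u x
    = lie_deriv \<sigma>0 u x + (\<Sum>j\<in>UNIV. a $ j * lie_deriv (\<lambda>z. column j (\<sigma> z)) u x)"
  by (simp add: lie_deriv_def affine_system_def inner_add_right matrix_mult_sum inner_sum_right
      scalar_mult_eq_scaleR)

text \<open>The iterated derivative is bilinear in the two fields, each of which is \<open>\<sigma>\<^sub>0\<close> plus a combination of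
  the columns of \<open>\<sigma>\<close>. The matrix \<open>S\<close> pairs the control \<open>b\<close> of the inner derivative with the control
  \<open>a\<close> of the outer one, in this order.\<close>

lemma second_lie_deriv_affine_system:
  fixes \<sigma> :: "real^'n \<Rightarrow> real^'m^'n" and x :: "real^'n"
  assumes u: "class_C 2 u" and \<sigma>0: "class_C 1 \<sigma>0" and \<sigma>: "class_C 1 \<sigma>"
  defines "p \<equiv> \<chi> j. lie_deriv \<sigma>0 (lie_deriv (\<lambda>z. column j (\<sigma> z)) u) x"
    and "q \<equiv> \<chi> j. lie_deriv (\<lambda>z. column j (\<sigma> z)) (lie_deriv \<sigma>0 u) x"
  shows "lie_deriv (\<lambda>z. affine_system \<sigma>0 \<sigma> z a) (lie_deriv (\<lambda>z. affine_system \<sigma>0 \<sigma> z b) u) x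
    = lie_deriv \<sigma>0 (lie_deriv \<sigma>0 u) x + q \<bullet> a + p \<bullet> b + b \<bullet> (S_mat u \<sigma> x *v a)"
proof -
  have u1: "class_C (Suc 1) u" using u by (simp only: Suc_1)
  let ?h = "\<lambda>j. lie_deriv (\<lambda>z. column j (\<sigma> z)) u"
  let ?f = "\<lambda>a z. affine_system \<sigma>0 \<sigma> z a"
  have h0: "class_C (Suc 0) (lie_deriv \<sigma>0 u)"
    using class_C_lie_deriv[OF u1 \<sigma>0] by simp
  have hj: "class_C (Suc 0) (?h j)" for j
    using class_C_lie_deriv[OF u1 class_C_bounded_linear[OF bounded_linear_column \<sigma>]] by simp
  have "((\<lambda>z. lie_deriv \<sigma>0 u z + (\<Sum>j\<in>UNIV. b $ j * ?h j z)) has_derivative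
      (\<lambda>v. frechet_derivative (lie_deriv \<sigma>0 u) (at x) v
         + (\<Sum>j\<in>UNIV. b $ j * frechet_derivative (?h j) (at x) v))) (at x)"
    by (intro has_derivative_add has_derivative_sum has_derivative_mult_right
        class_C_has_derivative[OF h0] class_C_has_derivative[OF hj])
  then have D: "frechet_derivative (lie_deriv (?f b) u) (at x) = (\<lambda>v. frechet_derivative (lie_deriv \<sigma>0 u) (at x) v
         + (\<Sum>j\<in>UNIV. b $ j * frechet_derivative (?h j) (at x) v))"
    unfolding lie_deriv_affine_system[abs_def] by (rule frechet_derivative_at[symmetric])
  have "class_C (Suc 0) (lie_deriv (?f b) u)"
    unfolding lie_deriv_affine_system[abs_def]
    by (intro class_C_add class_C_sum h0 class_C_bounded_linear[OF bounded_linear_mult_right] hj)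
  note hb = this
  have eq: "lie_deriv g (lie_deriv (?f b) u) x = lie_deriv g (lie_deriv \<sigma>0 u) x
      + (\<Sum>j\<in>UNIV. b $ j * lie_deriv g (?h j) x)" for g
    unfolding lie_deriv_def[of g] inner_grad[OF h0] inner_grad[OF hj] inner_grad[OF hb] D by (rule refl)
  have "b \<bullet> (S_mat u \<sigma> x *v a)
      = (\<Sum>j\<in>UNIV. b $ j * (\<Sum>i\<in>UNIV. a $ i * lie_deriv (\<lambda>z. column i (\<sigma> z)) (?h j) x))"
    by (simp add: inner_vec_def[of b] matrix_vector_mult_def S_mat_def lie_deriv_def[abs_def] mult.commute)
  also have "\<dots> = (\<Sum>i\<in>UNIV. a $ i * (\<Sum>j\<in>UNIV. b $ j * lie_deriv (\<lambda>z. column i (\<sigma> z)) (?h j) x))"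
    by (simp add: sum_distrib_left mult.left_commute, rule sum.swap)
  finally show ?thesis
    unfolding eq lie_deriv_affine_system[of \<sigma>0 \<sigma> a]
    by (simp add: p_def q_def inner_vec_def[of _ a] inner_vec_def[of _ b] distrib_left sum.distrib mult.commute)
qed

lemma sum_UNIV_sum_type:
  fixes f :: "('m::finite + 'k::finite) \<Rightarrow> 'a::comm_monoid_add"
  shows "sum f UNIV = (\<Sum>i\<in>UNIV. f (Inl i)) + (\<Sum>i\<in>UNIV. f (Inr i))"
  using sum.Plus[of "UNIV :: 'm set" "UNIV :: 'k set" f] by (simp add: UNIV_Plus_UNIV comp_def)

lemma block_matrix_quadratic_form:
  fixes A B C D :: "real^'m^'m"
  defines "l \<equiv> \<lambda>v. \<chi> i. v $ Inl i" and "r \<equiv> \<lambda>v. \<chi> i. v $ Inr i"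
  shows "v \<bullet> (block_matrix A B C D *v v)
    = l v \<bullet> (A *v l v) + l v \<bullet> (B *v r v) + r v \<bullet> (C *v l v) + r v \<bullet> (D *v r v)"
  by (simp add: l_def r_def block_matrix_def inner_vec_def matrix_vector_mult_def sum_UNIV_sum_type
      distrib_left sum.distrib sum_distrib_left)

lemma inner_transpose: "a \<bullet> (transpose A *v b) = b \<bullet> (A *v a)" for A :: "real^'m^'k"
  by (metis dot_lmul_matrix inner_commute transpose_matrix_vector)

lemma inner_sym_part: "a \<bullet> (sym_part A *v a) = a \<bullet> (A *v a)"
proof -
  have "sym_part A *v a = (1/2) *\<^sub>R (A *v a + transpose A *v a)"
    by (simp only: sym_part_def scaleR_matrix_vector_assoc[symmetric] matrix_vector_mult_add_rdistrib)
  then show ?thesis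
    by (simp add: inner_add_right inner_transpose del: transpose_matrix_vector)
qed

text \<open>The halves of a vector are the controls of the two legs. The diagonal blocks of \<open>K\<close> may be
  replaced by \<open>S\<close> in its quadratic form, and the two off-diagonal blocks contribute equally.\<close>

lemma not_pos_semidef_K_mat:
  fixes u :: "real^'n \<Rightarrow> real" and \<sigma> :: "real^'n \<Rightarrow> real^'m^'n" and x :: "real^'n"
  defines "S \<equiv> S_mat u \<sigma> x"
  assumes "\<not> pos_semidef (K_mat u \<sigma> x)"
  obtains a b :: "real^'m" where "a \<bullet> (S *v a) + b \<bullet> (S *v b) + 2 * (b \<bullet> (S *v a)) < 0"
proof -
  obtain v where v: "v \<bullet> (K_mat u \<sigma> x *v v) < 0"
    using assms by (auto simp: pos_semidef_def not_le)
  from v show thesis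
    by (intro that[of "\<chi> i. v $ Inl i" "\<chi> i. v $ Inr i"])
      (simp add: K_mat_def Let_def block_matrix_quadratic_form inner_sym_part inner_transpose
        del: transpose_matrix_vector flip: S_def)
qed

text \<open>If \<open>p \<noteq> q\<close>, then the linear part is nonzero, and a short step against its gradient makes it
  dominate the quadratic part. If \<open>p = q\<close>, then a direction in which the quadratic part is negative
  is scaled into the unit ball, with the sign that makes the linear part nonpositive.\<close>

lemma exists_negative_value:
  fixes S :: "real^'m^'m" and p q :: "real^'m"
  assumes c: "c \<le> 0"
    and "p \<noteq> q \<or> (\<exists>a b. a \<bullet> (S *v a) + b \<bullet> (S *v b) + 2 * (b \<bullet> (S *v a)) < 0)"
  obtains a b where "norm a \<le> 1" "norm b \<le> 1"
    "4 * c + (p + 3 *\<^sub>R q) \<bullet> a + (3 *\<^sub>R p + q) \<bullet> b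
      + (a \<bullet> (S *v a) + b \<bullet> (S *v b) + 2 * (b \<bullet> (S *v a))) < 0"
proof -
  define Q where "Q a b = a \<bullet> (S *v a) + b \<bullet> (S *v b) + 2 * (b \<bullet> (S *v a))" for a b
  define l where "l a b = (p + 3 *\<^sub>R q) \<bullet> a + (3 *\<^sub>R p + q) \<bullet> b" for a b
  have Q_scale: "Q (s *\<^sub>R a) (s *\<^sub>R b) = s\<^sup>2 * Q a b" for s a b
    by (simp add: Q_def scaleR_vector_matrix_assoc[symmetric] matrix_vector_mult_scaleR power2_eq_square algebra_simps)
  have l_scale: "l (s *\<^sub>R a) (s *\<^sub>R b) = s * l a b" for s a b
    by (simp add: l_def algebra_simps)
  have "\<exists>a b. norm a \<le> 1 \<and> norm b \<le> 1 \<and> l a b + Q a b < 0"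
  proof (cases "p = q")
    case False
    define v w where "v = p + 3 *\<^sub>R q" and "w = 3 *\<^sub>R p + q"
    define N where "N = v \<bullet> v + w \<bullet> w"
    have vw: "v \<noteq> 0 \<or> w \<noteq> 0"
    proof (rule ccontr)
      assume "\<not> (v \<noteq> 0 \<or> w \<noteq> 0)"
      then have "v - w = 0" by simp
      moreover have "v - w = (-2) *\<^sub>R (p - q)" by (simp add: v_def w_def vec_eq_iff)
      ultimately show False using False by simp
    qed
    then have N: "0 < N"
      unfolding N_def by (metis add_pos_nonneg add_nonneg_pos inner_ge_zero inner_gt_zero_iff)
    \<comment> \<open>The first bound keeps the step in the unit ball, the second makes \<open>s\<^sup>2 Q\<close> smaller than \<open>s N\<close>.\<close>
    define s where "s = min (1 / (1 + norm v + norm w)) (N / (2 * (\<bar>Q v w\<bar> + 1)))"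
    have d: "0 < 1 + norm v + norm w" by (smt (verit) norm_ge_zero)
    have s: "0 < s" using d N by (simp add: s_def)
    have "s * (1 + norm v + norm w) \<le> 1"
      using d mult_right_mono[of s "1 / (1 + norm v + norm w)" "1 + norm v + norm w"] by (simp add: s_def)
    then have n: "norm (s *\<^sub>R v) \<le> 1" "norm (s *\<^sub>R w) \<le> 1"
      using s by (auto simp: distrib_left intro: order_trans[rotated])
    have "s * (2 * (\<bar>Q v w\<bar> + 1)) \<le> N"
      using mult_right_mono[of s "N / (2 * (\<bar>Q v w\<bar> + 1))" "2 * (\<bar>Q v w\<bar> + 1)"] by (simp add: s_def)
    moreover have "s * Q v w < s * (2 * (\<bar>Q v w\<bar> + 1))"
      using s by (intro mult_strict_left_mono) auto
    ultimately have "s * Q v w < N" by simp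
    then have "s * (- N + s * Q v w) < 0"
      using s by (intro mult_pos_neg) auto
    moreover have "l (- (s *\<^sub>R v)) (- (s *\<^sub>R w)) + Q (- (s *\<^sub>R v)) (- (s *\<^sub>R w)) = s * (- N + s * Q v w)"
      using l_scale[of "- s" v w] Q_scale[of "- s" v w]
      by (simp add: l_def[of v w] N_def flip: v_def w_def) (simp add: algebra_simps power2_eq_square)
    ultimately show ?thesis
      using n by (intro exI[of _ "- (s *\<^sub>R v)"] exI[of _ "- (s *\<^sub>R w)"]) simp
  next
    case True
    then obtain a b where ab: "Q a b < 0" using assms(2) by (auto simp: Q_def)
    define s where "s = (if l a b \<le> 0 then 1 else -1) / (1 + norm a + norm b)"
    have d: "0 < 1 + norm a + norm b" by (smt (verit) norm_ge_zero)
    have s: "\<bar>s\<bar> * (1 + norm a + norm b) = 1" "s \<noteq> 0" "s * l a b \<le> 0"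
      using d by (auto simp: s_def abs_mult divide_nonpos_pos)
    have "\<bar>s\<bar> * norm a \<le> \<bar>s\<bar> * (1 + norm a + norm b)" "\<bar>s\<bar> * norm b \<le> \<bar>s\<bar> * (1 + norm a + norm b)"
      by (auto intro: mult_left_mono)
    with s have "norm (s *\<^sub>R a) \<le> 1" "norm (s *\<^sub>R b) \<le> 1" "l (s *\<^sub>R a) (s *\<^sub>R b) + Q (s *\<^sub>R a) (s *\<^sub>R b) < 0"
      using ab by (auto simp: l_scale Q_scale add_nonpos_neg mult_pos_neg)
    then show ?thesis by blast
  qed
  then show thesis
    using c that unfolding l_def Q_def by (smt (verit))
qed

section \<open>Existence of trajectories\<close>

text \<open>Banach's fixed point theorem for the integral operator on continuous curves in the ball. The
  field may depend on time discontinuously, since only its integrals along continuous curves enter;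
  this covers controls with jumps without gluing solutions.\<close>

lemma integral_equation_solution:
  fixes G :: "real \<Rightarrow> 'a::euclidean_space \<Rightarrow> 'a"
  assumes h: "0 < h" and L: "0 \<le> L" "L * h < 1" and B: "0 \<le> B" "dist p x + B * h \<le> \<rho>"
    and lip: "\<And>r. r \<in> {0..h} \<Longrightarrow> L-lipschitz_on (cball p \<rho>) (G r)"
    and bd: "\<And>r z. r \<in> {0..h} \<Longrightarrow> z \<in> cball p \<rho> \<Longrightarrow> norm (G r z) \<le> B"
    and int: "\<And>y. continuous_on {0..h} y \<Longrightarrow> y \<in> {0..h} \<rightarrow> cball p \<rho> \<Longrightarrow>
                (\<lambda>r. G r (y r)) integrable_on {0..h}"
  obtains y where "continuous_on {0..h} y" "y \<in> {0..h} \<rightarrow> cball p \<rho>"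
    "\<And>s. s \<in> {0..h} \<Longrightarrow> y s = x + integral {0..s} (\<lambda>r. G r (y r))"
proof -
  \<comment> \<open>Clamping the time to \<open>[0,h]\<close> makes the operator act on bounded continuous functions on the whole line.\<close>
  define cl where "cl s = max 0 (min h s)" for s :: real
  have cl: "cl s \<in> {0..h}" "cl s \<le> h" "0 \<le> cl s" for s
    using h by (auto simp: cl_def)
  have cl_id: "cl s = s" if "s \<in> {0..h}" for s
    using that by (auto simp: cl_def)
  have cl_cont: "continuous_on UNIV cl"
    unfolding cl_def[abs_def] by (intro continuous_intros)
  define T where "T = PiC (UNIV :: real set) (\<lambda>_. cball p \<rho>)"
  have T: "y \<in> T \<longleftrightarrow> (\<forall>s. apply_bcontfun y s \<in> cball p \<rho>)" for y
    by (auto simp: T_def mem_PiC_iff)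
  define \<Phi> where "\<Phi> y s = x + integral {0..cl s} (\<lambda>r. G r (apply_bcontfun y r))" for y s
  have int': "(\<lambda>r. G r (apply_bcontfun y r)) integrable_on {0..h}" if "y \<in> T" for y
    using that by (intro int) (auto simp: T)
  have int_cl: "(\<lambda>r. G r (apply_bcontfun y r)) integrable_on {0..cl s}" if "y \<in> T" for y s
    using int'[OF that] by (rule integrable_subinterval_real) (use cl in auto)
  have \<Phi>_ball: "\<Phi> y s \<in> cball p \<rho>" if "y \<in> T" for y s
  proof -
    have "norm (integral {0..cl s} (\<lambda>r. G r (apply_bcontfun y r))) \<le> B * measure lborel {0..cl s}"
      by (rule has_integral_bound_real[OF B(1) finite.emptyI integrable_integral[OF int_cl[OF that]]])
        (use that cl(2)[of s] in \<open>auto intro!: bd simp: T simp del: mem_cball\<close>)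
    also have "\<dots> \<le> B * h"
      using cl[of s] B by (auto intro: mult_left_mono)
    finally have "dist x (\<Phi> y s) \<le> B * h"
      by (simp add: \<Phi>_def dist_norm)
    then show ?thesis
      using B dist_triangle[of p "\<Phi> y s" x] by simp
  qed
  have \<Phi>_bcontfun: "\<Phi> y \<in> bcontfun" if "y \<in> T" for y
  proof -
    have "continuous_on {0..h} (\<lambda>s. integral {0..s} (\<lambda>r. G r (apply_bcontfun y r)))"
      by (rule indefinite_integral_continuous_1[OF int'[OF that]])
    then have "continuous_on UNIV (\<lambda>s. integral {0..cl s} (\<lambda>r. G r (apply_bcontfun y r)))"
      by (rule continuous_on_compose2[OF _ cl_cont]) (use cl in auto)
    then have "continuous_on UNIV (\<Phi> y)"
      unfolding \<Phi>_def[abs_def] by (intro continuous_on_add continuous_on_const)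
    moreover have "bounded (range (\<Phi> y))"
      using \<Phi>_ball[OF that] by (intro bounded_subset[OF bounded_cball]) auto
    ultimately show ?thesis by (simp add: bcontfun_def)
  qed
  have app: "apply_bcontfun (Bcontfun (\<Phi> y)) = \<Phi> y" if "y \<in> T" for y
    using \<Phi>_bcontfun[OF that] by (rule Bcontfun_inverse)
  have "\<exists>!y\<in>T. Bcontfun (\<Phi> y) = y"
  proof (rule Banach_fix)
    show "complete T"
      unfolding T_def complete_eq_closed by (intro closed_PiC) auto
    have "0 \<le> \<rho>"
      using B h by (smt (verit) mult_nonneg_nonneg zero_le_dist)
    then have "const_bcontfun p \<in> T"
      by (auto simp: T const_bcontfun.rep_eq)
    then show "T \<noteq> {}" by blast
    show "0 \<le> L * h" "L * h < 1" using L h by auto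
    show "(\<lambda>y. Bcontfun (\<Phi> y)) ` T \<subseteq> T"
      using \<Phi>_ball by (auto simp: T app simp del: mem_cball)
    fix y z assume y: "y \<in> T" and z: "z \<in> T"
    show "dist (Bcontfun (\<Phi> y)) (Bcontfun (\<Phi> z)) \<le> L * h * dist y z"
    proof (rule dist_bound)
      fix s
      have "norm (G r (apply_bcontfun y r) - G r (apply_bcontfun z r)) \<le> L * dist y z"
        if "r \<in> {0..cl s}" for r
      proof -
        have "norm (G r (apply_bcontfun y r) - G r (apply_bcontfun z r))
            \<le> L * dist (apply_bcontfun y r) (apply_bcontfun z r)"
          unfolding dist_norm[symmetric]
          by (rule lipschitz_onD[OF lip]) (use y z that cl(2)[of s] in \<open>auto simp: T simp del: mem_cball\<close>)
        also have "\<dots> \<le> L * dist y z"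
          using L by (intro mult_left_mono dist_bounded)
        finally show ?thesis .
      qed
      then have "norm (integral {0..cl s} (\<lambda>r. G r (apply_bcontfun y r))
          - integral {0..cl s} (\<lambda>r. G r (apply_bcontfun z r))) \<le> L * dist y z * measure lborel {0..cl s}"
        using L
        by (intro has_integral_bound_real[OF _ finite.emptyI
              has_integral_diff[OF integrable_integral[OF int_cl[OF y]] integrable_integral[OF int_cl[OF z]]]])
          auto
      also have "\<dots> \<le> L * dist y z * h"
        using cl[of s] L by (auto intro!: mult_left_mono)
      finally show "dist (apply_bcontfun (Bcontfun (\<Phi> y)) s) (apply_bcontfun (Bcontfun (\<Phi> z)) s)
          \<le> L * h * dist y z"
        by (simp add: app y z \<Phi>_def dist_norm mult_ac)
    qed
  qed
  then obtain y where y: "y \<in> T" "Bcontfun (\<Phi> y) = y"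
    by blast
  show thesis
  proof (rule that)
    show "continuous_on {0..h} (apply_bcontfun y)" by simp
    show "apply_bcontfun y \<in> {0..h} \<rightarrow> cball p \<rho>"
      using y(1) by (auto simp: T)
    show "apply_bcontfun y s = x + integral {0..s} (\<lambda>r. G r (apply_bcontfun y r))"
      if "s \<in> {0..h}" for s
      using app[OF y(1)] unfolding y(2) by (simp add: \<Phi>_def[of y s] cl_id[OF that])
  qed
qed

definition switch :: "real \<Rightarrow> 'a \<Rightarrow> 'a \<Rightarrow> real \<Rightarrow> 'a" where
  "switch t a b = (\<lambda>r. if r \<le> t then a else b)"

lemma switch_in_controls:
  assumes "norm a \<le> 1" "norm b \<le> 1"
  shows "switch t a b \<in> controls"
proof -
  have "piecewise_constant (switch t a b)"
    unfolding piecewise_constant_def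
  proof (intro allI impI exI conjI ballI)
    fix R :: real and J assume J: "J \<in> {{0..R} \<inter> {..t}, {0..R} \<inter> {t<..}}"
    show "is_interval J"
      using J by (auto intro!: is_interval_Int is_interval_cc is_interval_ic is_interval_oi)
    show "switch t a b constant_on J"
      using J by (auto simp: constant_on_def switch_def)
  qed auto
  with assms show ?thesis
    by (auto simp: controls_def switch_def)
qed

text \<open>Where the control is locally constant the integrand is continuous, so the integral is
  differentiable there.\<close>

lemma solution_on_of_integral_equation:
  fixes F :: "'a::euclidean_space \<Rightarrow> 'c \<Rightarrow> 'a"
  assumes h: "0 < h" and y: "continuous_on {0..h} y"
    and F: "\<And>c. continuous_on UNIV (\<lambda>z. F z c)"
    and int: "(\<lambda>r. F (y r) (\<alpha> r)) integrable_on {0..h}"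
    and eq: "\<And>s. s \<in> {0..h} \<Longrightarrow> y s = x + integral {0..s} (\<lambda>r. F (y r) (\<alpha> r))"
  shows "solution_on F \<alpha> x (ereal h) y"
  unfolding solution_on_def
proof (intro conjI allI impI)
  show "y 0 = x" using eq[of 0] h by simp
  show "continuous_on {t. 0 \<le> t \<and> ereal t < ereal h} y"
    using y by (rule continuous_on_subset) auto
  fix s assume s: "0 < s \<and> ereal s < ereal h \<and> (\<forall>\<^sub>F r in nhds s. \<alpha> r = \<alpha> s)"
  then have s': "s \<in> {0<..<h}" by auto
  have at: "at s within {0..h} = at s"
    using s' by (intro at_within_interior) auto
  have "isCont y s"
    using y s' continuous_on_interior[of "{0..h}" y s] by auto
  then have "((\<lambda>r. F (y r) (\<alpha> s)) \<longlongrightarrow> F (y s) (\<alpha> s)) (at s)"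
    using F[of "\<alpha> s"]
    by (intro isCont_tendsto_compose[of _ "\<lambda>z. F z (\<alpha> s)"])
      (auto simp: continuous_on_eq_continuous_at intro: isContD)
  moreover have "\<forall>\<^sub>F r in at s. \<alpha> r = \<alpha> s"
    using s by (auto simp: eventually_at_filter elim: eventually_mono)
  ultimately have "((\<lambda>r. F (y r) (\<alpha> r)) \<longlongrightarrow> F (y s) (\<alpha> s)) (at s)"
    by (elim Lim_transform_eventually) (auto elim: eventually_mono)
  then have "((\<lambda>s. integral {0..s} (\<lambda>r. F (y r) (\<alpha> r))) has_vector_derivative F (y s) (\<alpha> s)) (at s)"
    using integral_has_vector_derivative_continuous_at[OF int, of s "{}"] s'
    by (simp add: at continuous_within)
  then have "((\<lambda>s. x + integral {0..s} (\<lambda>r. F (y r) (\<alpha> r))) has_vector_derivative F (y s) (\<alpha> s)) (at s)"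
    using has_vector_derivative_add[OF has_vector_derivative_const] by fastforce
  then show "(y has_vector_derivative F (y s) (\<alpha> s)) (at s)"
    by (rule has_vector_derivative_transform_within_open[where S = "{0<..<h}"])
      (use s' eq in auto)
qed (use h in auto)

text \<open>The existence time \<open>h\<close> depends on neither the starting point nor the switching time; the descent
  argument needs this, as there the former tends to \<open>p\<close> and the latter to \<open>0\<close> together.\<close>

lemma local_switched_solution:
  fixes F :: "'a::euclidean_space \<Rightarrow> 'c \<Rightarrow> 'a"
  assumes F: "\<And>c. class_C 1 (\<lambda>z. F z c)" and \<rho>: "0 < \<rho>"
  obtains h where "0 < h"
    "\<And>x t. x \<in> cball p (\<rho> / 2) \<Longrightarrow>
      \<exists>y. solution_on F (switch t a b) x (ereal h) y \<and> (\<forall>s. 0 \<le> s \<and> s < h \<longrightarrow> y s \<in> cball p \<rho>)"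
proof -
  have cont: "continuous_on S (\<lambda>z. F z c)" for c S
    using class_C_imp_continuous[OF F] continuous_on_subset by blast
  have "\<exists>L>0. L-lipschitz_on (cball p \<rho>) (\<lambda>z. F z c)" for c
    using class_C_imp_lipschitz_on_cball[of 0 "\<lambda>z. F z c" p \<rho>] F[of c] by (metis One_nat_def)
  then obtain La Lb where L: "0 < La" "La-lipschitz_on (cball p \<rho>) (\<lambda>z. F z a)"
     "0 < Lb" "Lb-lipschitz_on (cball p \<rho>) (\<lambda>z. F z b)"
    by metis
  define L where "L = max La Lb"
  have lip: "L-lipschitz_on (cball p \<rho>) (\<lambda>z. F z (switch t a b r))" for t r
    using L by (auto simp: switch_def L_def intro: lipschitz_on_le)
  have "\<exists>B>0. \<forall>z\<in>cball p \<rho>. norm (F z c) \<le> B" for c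
    using compact_imp_bounded[OF compact_continuous_image[OF cont[of "cball p \<rho>" c] compact_cball]]
    by (auto simp: bounded_pos)
  then obtain Ba Bb where B: "0 < Ba" "\<And>z. z \<in> cball p \<rho> \<Longrightarrow> norm (F z a) \<le> Ba"
      "0 < Bb" "\<And>z. z \<in> cball p \<rho> \<Longrightarrow> norm (F z b) \<le> Bb"
    by metis
  define B where "B = max Ba Bb"
  have bd: "norm (F z (switch t a b r)) \<le> B" if "z \<in> cball p \<rho>" for z t r
    using B(2,4)[OF that] by (auto simp: switch_def B_def)
  have pos: "0 < L" "0 < B" using L B by (auto simp: L_def B_def)
  \<comment> \<open>Contraction constant at most \<open>1/2\<close>, and displacement at most \<open>\<rho>/2\<close>.\<close>
  define h where "h = min (1 / (2 * L)) (\<rho> / (2 * B))"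
  have h: "0 < h" "L * h < 1" "B * h \<le> \<rho> / 2"
  proof -
    show "0 < h" using pos \<rho> by (simp add: h_def)
    have "L * h \<le> L * (1 / (2 * L))" using pos by (intro mult_left_mono) (auto simp: h_def)
    also have "\<dots> < 1" using pos by simp
    finally show "L * h < 1" .
    have "B * h \<le> B * (\<rho> / (2 * B))" using pos by (intro mult_left_mono) (auto simp: h_def)
    then show "B * h \<le> \<rho> / 2" using pos by simp
  qed
  show thesis
  proof (rule that[OF h(1)])
    fix x t assume x: "x \<in> cball p (\<rho> / 2)"
    have int: "(\<lambda>r. F (y r) (switch t a b r)) integrable_on {0..h}" if "continuous_on {0..h} y" for y
    proof -
      have i: "(\<lambda>r. F (y r) c) integrable_on {c1..c2}" if "{c1..c2} \<subseteq> {0..h}" for c c1 c2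
        using continuous_on_subset[OF \<open>continuous_on {0..h} y\<close> that] cont[of UNIV c]
        by (intro integrable_continuous_real) (rule continuous_on_compose2[of UNIV "\<lambda>z. F z c"], auto)
      \<comment> \<open>The switching time clamped to \<open>[0,h]\<close>: up to finitely many times the integrand is continuous on either side.\<close>
      define m where "m = max 0 (min h t)"
      have m: "0 \<le> m" "m \<le> h" using h by (auto simp: m_def)
      have "(\<lambda>r. F (y r) (switch t a b r)) integrable_on {0..m}"
        by (rule integrable_spike_finite[of "{0}" _ _ "\<lambda>r. F (y r) a"])
          (use m in \<open>auto intro!: i simp: switch_def m_def\<close>)
      moreover have "(\<lambda>r. F (y r) (switch t a b r)) integrable_on {m..h}"
        by (rule integrable_spike_finite[of "{m, h}" _ _ "\<lambda>r. F (y r) b"])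
          (use m in \<open>auto intro!: i simp: switch_def m_def\<close>)
      ultimately show ?thesis
        by (rule Henstock_Kurzweil_Integration.integrable_combine[OF m])
    qed
    have "dist p x + B * h \<le> \<rho>" using x h by simp
    from integral_equation_solution[OF h(1) less_imp_le[OF pos(1)] h(2) less_imp_le[OF pos(2)] this lip bd int]
    obtain y where y: "continuous_on {0..h} y" "y \<in> {0..h} \<rightarrow> cball p \<rho>"
      "\<And>s. s \<in> {0..h} \<Longrightarrow> y s = x + integral {0..s} (\<lambda>r. F (y r) (switch t a b r))"
      by blast
    have "solution_on F (switch t a b) x (ereal h) y"
      by (rule solution_on_of_integral_equation) (use h y int cont in auto)
    then show "\<exists>y. solution_on F (switch t a b) x (ereal h) y \<and> (\<forall>s. 0 \<le> s \<and> s < h \<longrightarrow> y s \<in> cball p \<rho>)"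
      using y(2) by (intro exI[of _ y]) auto
  qed
qed

text \<open>Zorn's lemma on graphs of solutions ordered by inclusion. A chain of solutions glues to a
  solution because continuity and the differential equation are local conditions.\<close>

lemma solution_on_extends_to_trajectory:
  assumes "solution_on F a x \<tau> y"
  obtains \<tau>' y' where "trajectory F a x \<tau>' y'" "\<tau> \<le> \<tau>'" "\<And>t. 0 \<le> t \<Longrightarrow> ereal t < \<tau> \<Longrightarrow> y' t = y t"
proof -
  define graph where "graph \<tau> y = {(t, y t) |t. 0 \<le> t \<and> ereal t < \<tau>}" for \<tau> :: ereal and y :: "real \<Rightarrow> 'a"
  have graph_subset: "graph \<tau>1 y1 \<subseteq> graph \<tau>2 y2 \<longleftrightarrow>
      (\<forall>t. 0 \<le> t \<and> ereal t < \<tau>1 \<longrightarrow> ereal t < \<tau>2 \<and> y2 t = y1 t)" for \<tau>1 \<tau>2 y1 y2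
    by (auto simp: graph_def)
  have dom_le: "\<tau>1 \<le> \<tau>2" if "\<And>t. 0 \<le> t \<Longrightarrow> ereal t < \<tau>1 \<Longrightarrow> ereal t < \<tau>2" "0 < \<tau>2" for \<tau>1 \<tau>2
  proof (rule ccontr)
    assume "\<not> \<tau>1 \<le> \<tau>2"
    then obtain t where t: "\<tau>2 < ereal t" "ereal t < \<tau>1"
      using ereal_dense2[of \<tau>2 \<tau>1] by (auto simp: not_le)
    have "0 < ereal t" using that(2) t(1) by (rule less_trans)
    then have "0 \<le> t" by simp
    then have "ereal t < \<tau>2" using t(2) by (rule that(1))
    with t(1) show False by simp
  qed
  define \<A> where "\<A> = {graph \<tau>' y' |\<tau>' y'. solution_on F a x \<tau>' y' \<and> graph \<tau> y \<subseteq> graph \<tau>' y'}"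
  have "\<exists>M\<in>\<A>. \<forall>X\<in>\<A>. M \<subseteq> X \<longrightarrow> X = M"
  proof (rule subset_Zorn_nonempty)
    show "\<A> \<noteq> {}" using assms by (auto simp: \<A>_def)
  next
    fix \<C> assume ne: "\<C> \<noteq> {}" and chain: "subset.chain \<A> \<C>"
    then have "\<forall>G\<in>\<C>. \<exists>\<tau>' y'. G = graph \<tau>' y' \<and> solution_on F a x \<tau>' y' \<and> graph \<tau> y \<subseteq> graph \<tau>' y'"
      by (auto simp: \<A>_def subset.chain_def)
    then obtain \<theta> \<eta> where \<theta>: "\<And>G. G \<in> \<C> \<Longrightarrow> G = graph (\<theta> G) (\<eta> G)"
        "\<And>G. G \<in> \<C> \<Longrightarrow> solution_on F a x (\<theta> G) (\<eta> G)" "\<And>G. G \<in> \<C> \<Longrightarrow> graph \<tau> y \<subseteq> G"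
      by metis
    have agree: "\<eta> G t = \<eta> H t" if "G \<in> \<C>" "H \<in> \<C>" "0 \<le> t" "ereal t < \<theta> G" "ereal t < \<theta> H" for G H t
    proof -
      have "G \<subseteq> H \<or> H \<subseteq> G" using chain that by (auto simp: subset.chain_def)
      then have "graph (\<theta> G) (\<eta> G) \<subseteq> graph (\<theta> H) (\<eta> H) \<or> graph (\<theta> H) (\<eta> H) \<subseteq> graph (\<theta> G) (\<eta> G)"
        using \<theta>(1) that by metis
      then show ?thesis using that by (auto simp: graph_subset)
    qed
    define \<tau>' where "\<tau>' = (SUP G\<in>\<C>. \<theta> G)"
    define y' where "y' t = \<eta> (SOME G. G \<in> \<C> \<and> ereal t < \<theta> G) t" for t
    have below: "\<exists>G\<in>\<C>. ereal t < \<theta> G" if "ereal t < \<tau>'" for t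
      using that by (auto simp: \<tau>'_def less_SUP_iff)
    have le: "\<theta> G \<le> \<tau>'" if "G \<in> \<C>" for G
      using that by (auto simp: \<tau>'_def intro: SUP_upper)
    have y': "y' t = \<eta> G t" if "G \<in> \<C>" "0 \<le> t" "ereal t < \<theta> G" for G t
      using someI[of "\<lambda>G. G \<in> \<C> \<and> ereal t < \<theta> G" G] that agree unfolding y'_def by blast
    have sol: "solution_on F a x \<tau>' y'"
      unfolding solution_on_def
    proof (intro conjI allI impI)
      obtain G where G: "G \<in> \<C>" using ne by blast
      have G0: "0 < \<theta> G" "\<eta> G 0 = x" using \<theta>(2)[OF G] by (auto simp: solution_on_def)
      then show "0 < \<tau>'" using le[OF G] by auto
      show "y' 0 = x" using y'[OF G, of 0] G0 by (simp add: zero_ereal_def)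
    next
      show "continuous_on {t. 0 \<le> t \<and> ereal t < \<tau>'} y'"
        unfolding continuous_on_eq_continuous_within
      proof
        fix t assume "t \<in> {t. 0 \<le> t \<and> ereal t < \<tau>'}"
        then obtain G where t: "0 \<le> t" and G: "G \<in> \<C>" "ereal t < \<theta> G" using below by blast
        obtain r where r: "t < r" "ereal r < \<theta> G"
          using ereal_dense2[OF G(2)] by auto
        have nb: "ereal z < \<theta> G" if "z < r" for z
          using that r(2) by (meson ereal_less_le less_imp_le less_ereal.simps(1) less_trans)
        have "continuous_on {t. 0 \<le> t \<and> ereal t < \<theta> G} (\<eta> G)"
          using \<theta>(2)[OF G(1)] by (simp add: solution_on_def)
        then have "continuous_on {t. 0 \<le> t \<and> ereal t < \<theta> G} y'"
          by (rule continuous_on_eq) (auto simp: y'[OF G(1)])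
        then have "continuous (at t within {t. 0 \<le> t \<and> ereal t < \<theta> G}) y'"
          using t G by (auto simp: continuous_on_eq_continuous_within)
        moreover have "at t within {t. 0 \<le> t \<and> ereal t < \<theta> G} = at t within {t. 0 \<le> t \<and> ereal t < \<tau>'}"
          by (rule at_within_nhd[of _ "{..<r}"])
            (use r(1) nb le[OF G(1)] in \<open>auto intro: less_le_trans\<close>)
        ultimately show "continuous (at t within {t. 0 \<le> t \<and> ereal t < \<tau>'}) y'"
          by simp
      qed
    next
      fix t assume t: "0 < t \<and> ereal t < \<tau>' \<and> (\<forall>\<^sub>F s in nhds t. a s = a t)"
      then obtain G where G: "G \<in> \<C>" "ereal t < \<theta> G" using below by blast
      obtain r where r: "t < r" "ereal r < \<theta> G"
        using ereal_dense2[OF G(2)] by auto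
      have nb: "ereal z < \<theta> G" if "z < r" for z
        using that r(2) by (meson less_ereal.simps(1) less_trans)
      have "(\<eta> G has_vector_derivative F (\<eta> G t) (a t)) (at t)"
        using \<theta>(2)[OF G(1)] t G by (auto simp: solution_on_def)
      then have "(y' has_vector_derivative F (\<eta> G t) (a t)) (at t)"
        by (rule has_vector_derivative_transform_within_open[where S = "{0<..<r}"])
          (use t r(1) nb y'[OF G(1)] in auto)
      then show "(y' has_vector_derivative F (y' t) (a t)) (at t)"
        using y'[OF G(1) _ G(2)] t by simp
    qed
    have "\<Union>\<C> = graph \<tau>' y'"
    proof
      show "\<Union>\<C> \<subseteq> graph \<tau>' y'"
      proof
        fix z assume "z \<in> \<Union>\<C>"
        then obtain G where G: "G \<in> \<C>" "z \<in> graph (\<theta> G) (\<eta> G)" using \<theta>(1) by blast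
        then show "z \<in> graph \<tau>' y'"
          using y'[OF G(1)] le[OF G(1)] by (auto simp: graph_def intro: less_le_trans)
      qed
      show "graph \<tau>' y' \<subseteq> \<Union>\<C>"
      proof
        fix z assume "z \<in> graph \<tau>' y'"
        then obtain t where t: "z = (t, y' t)" "0 \<le> t" "ereal t < \<tau>'" by (auto simp: graph_def)
        then obtain G where G: "G \<in> \<C>" "ereal t < \<theta> G" using below by blast
        then have "z \<in> graph (\<theta> G) (\<eta> G)" using t y'[OF G(1)] by (auto simp: graph_def)
        then show "z \<in> \<Union>\<C>" using \<theta>(1)[OF G(1)] G(1) by auto
      qed
    qed
    moreover have "graph \<tau> y \<subseteq> \<Union>\<C>" using ne \<theta>(3) by blast
    ultimately show "\<Union>\<C> \<in> \<A>" using sol by (auto simp: \<A>_def)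
  qed
  then obtain \<tau>' y' where sol: "solution_on F a x \<tau>' y'" and ext: "graph \<tau> y \<subseteq> graph \<tau>' y'"
      and max: "\<And>X. X \<in> \<A> \<Longrightarrow> graph \<tau>' y' \<subseteq> X \<Longrightarrow> X = graph \<tau>' y'"
    by (auto simp: \<A>_def)
  have pos: "0 < \<tau>'" using sol by (simp add: solution_on_def)
  show thesis
  proof (rule that)
    show "\<tau> \<le> \<tau>'" using ext pos by (intro dom_le) (auto simp: graph_subset)
    show "y' t = y t" if "0 \<le> t" "ereal t < \<tau>" for t
      using ext that by (auto simp: graph_subset)
    show "trajectory F a x \<tau>' y'"
      unfolding trajectory_def
    proof (intro conjI sol allI impI)
      fix \<tau>'' y''
      assume *: "solution_on F a x \<tau>'' y'' \<and> (\<forall>t. 0 \<le> t \<and> ereal t < \<tau>' \<longrightarrow> y'' t = y' t)"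
      show "\<tau>'' \<le> \<tau>'"
      proof (rule ccontr)
        assume "\<not> \<tau>'' \<le> \<tau>'"
        then have less: "\<tau>' < \<tau>''" by simp
        then have sub: "graph \<tau>' y' \<subseteq> graph \<tau>'' y''"
          using * by (auto simp: graph_subset)
        then have "graph \<tau>'' y'' = graph \<tau>' y'"
          using * ext by (intro max) (auto simp: \<A>_def)
        then have "\<tau>'' \<le> \<tau>'" using pos by (intro dom_le) (auto simp: graph_subset set_eq_subset)
        with less show False by simp
      qed
    qed
  qed
qed

section \<open>Descent by switching between two controls\<close>

text \<open>With \<open>d = 0\<close> this bounds the change of \<open>v\<close> from a bound on its derivative along the solution. A
  bound that grows linearly in time, as obtained from a second derivative of at most \<open>2 d\<close>, integrates
  to a second-order Taylor estimate.\<close>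

lemma growth_along_solution:
  assumes v: "class_C 1 v" and le: "s0 \<le> s1" and y: "continuous_on {s0..s1} y"
    and ode: "\<And>s. s0 < s \<Longrightarrow> s < s1 \<Longrightarrow> (y has_vector_derivative f (y s)) (at s)"
    and bound: "\<And>s. s0 < s \<Longrightarrow> s < s1 \<Longrightarrow> lie_deriv f v (y s) \<le> c + 2 * d * (s - s0)"
  shows "v (y s1) \<le> v (y s0) + c * (s1 - s0) + d * (s1 - s0)\<^sup>2"
proof -
  have v1: "class_C (Suc 0) v" using v by simp
  have der: "((\<lambda>s. v (y s)) has_real_derivative lie_deriv f v (y s)) (at s)" if "s0 < s" "s < s1" for s
    using vector_derivative_diff_chain_within[OF ode[OF that]
        has_derivative_at_withinI[OF class_C_has_derivative[OF v1]]]
    by (simp add: o_def has_real_derivative_iff_has_vector_derivative lie_deriv_def inner_grad[OF v1])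
  let ?\<phi> = "\<lambda>s. v (y s) - (c * (s - s0) + d * (s - s0)\<^sup>2)"
  have "?\<phi> s1 \<le> ?\<phi> s0"
  proof (rule DERIV_nonpos_imp_decreasing_open[OF le])
    show "continuous_on {s0..s1} ?\<phi>"
      using continuous_on_compose2[OF class_C_imp_continuous[OF v] y]
      by (intro continuous_intros) auto
    fix s assume s: "s0 < s" "s < s1"
    show "\<exists>z. (?\<phi> has_real_derivative z) (at s) \<and> z \<le> 0"
      using bound[OF s]
      by (intro exI[of _ "lie_deriv f v (y s) - (c + 2 * d * (s - s0))"] conjI)
        (auto intro!: derivative_eq_intros der[OF s])
  qed
  then show ?thesis by simp
qed

text \<open>The mixed term arises because the slope of \<open>u\<close> at the start of the second leg is the slope
  \<open>lie_deriv g u\<close> at the initial point, transported along \<open>f\<close> for the time \<open>t\<close>.\<close>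

lemma two_leg_estimate:
  assumes u: "class_C 2 u" and f: "class_C 1 f" and g: "class_C 1 g"
    and t: "0 \<le> t" and y: "continuous_on {0..2 * t} y"
    and leg1: "\<And>s. 0 < s \<Longrightarrow> s < t \<Longrightarrow> (y has_vector_derivative f (y s)) (at s)"
    and leg2: "\<And>s. t < s \<Longrightarrow> s < 2 * t \<Longrightarrow> (y has_vector_derivative g (y s)) (at s)"
    and ff: "\<And>s. s \<in> {0..2 * t} \<Longrightarrow> lie_deriv f (lie_deriv f u) (y s) \<le> \<alpha>"
    and fg: "\<And>s. s \<in> {0..2 * t} \<Longrightarrow> lie_deriv f (lie_deriv g u) (y s) \<le> \<beta>"
    and gg: "\<And>s. s \<in> {0..2 * t} \<Longrightarrow> lie_deriv g (lie_deriv g u) (y s) \<le> \<gamma>"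
  shows "u (y (2 * t)) \<le> u (y 0) + t * (lie_deriv f u (y 0) + lie_deriv g u (y 0))
    + t\<^sup>2 / 2 * (\<alpha> + 2 * \<beta> + \<gamma>)"
proof -
  have u2: "class_C (Suc 1) u" using u by (simp only: Suc_1)
  have u1: "class_C 1 u" using class_C_Suc_imp[OF u2] .
  have Lf: "class_C 1 (lie_deriv f u)" and Lg: "class_C 1 (lie_deriv g u)"
    using class_C_lie_deriv[OF u2] f g by auto
  have y1: "continuous_on {0..s} y" if "s \<le> t" for s
    using y by (rule continuous_on_subset) (use that t in auto)
  have y2: "continuous_on {t..s} y" if "s \<le> 2 * t" for s
    using y by (rule continuous_on_subset) (use that t in auto)
  have slope_f: "lie_deriv f u (y s) \<le> lie_deriv f u (y 0) + \<alpha> * s" if "0 \<le> s" "s \<le> t" for s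
    using growth_along_solution[OF Lf that(1) y1[OF that(2)], of f \<alpha> 0] leg1 ff that by auto
  have "lie_deriv g u (y t) \<le> lie_deriv g u (y 0) + \<beta> * t"
    using growth_along_solution[OF Lg t y1, of f \<beta> 0] leg1 fg t by auto
  then have slope_t: "t * lie_deriv g u (y t) \<le> t * (lie_deriv g u (y 0) + \<beta> * t)"
    using t by (rule mult_left_mono)
  have slope_g: "lie_deriv g u (y s) \<le> lie_deriv g u (y t) + \<gamma> * (s - t)" if "t \<le> s" "s \<le> 2 * t" for s
    using growth_along_solution[OF Lg that(1) y2[OF that(2)], of g \<gamma> 0] leg2 gg that t by auto
  have "u (y t) \<le> u (y 0) + lie_deriv f u (y 0) * (t - 0) + \<alpha> / 2 * (t - 0)\<^sup>2"
    by (rule growth_along_solution[OF u1 t y1 leg1]) (use slope_f in auto)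
  moreover have "u (y (2 * t)) \<le> u (y t) + lie_deriv g u (y t) * (2 * t - t) + \<gamma> / 2 * (2 * t - t)\<^sup>2"
    by (rule growth_along_solution[OF u1 _ y2 leg2]) (use slope_g t in auto)
  ultimately show ?thesis
    using slope_t by (simp add: field_simps power2_eq_square)
qed

text \<open>Let \<open>\<kappa>\<close> be minus the second-order coefficient and \<open>\<delta>\<close> the distance of \<open>x\<close> from \<open>p\<close>. Near \<open>p\<close> the coefficient stays
  below \<open>- \<kappa> / 2\<close>, so that two legs of length \<open>t \<le> 1\<close> from \<open>x\<close> lead to a value of \<open>u\<close> of at most
  \<open>u p + L \<delta> + t L \<delta> - \<kappa> t\<^sup>2 / 4 \<le> u p + 2 L \<delta> - \<kappa> t\<^sup>2 / 4\<close>. The legs are chosen such that the right-hand side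
  equals \<open>u p\<close>.\<close>

lemma switching_reaches_sublevel:
  fixes F :: "real^'n \<Rightarrow> 'c \<Rightarrow> real^'n" and u :: "real^'n \<Rightarrow> real"
  assumes F: "\<And>c. class_C 1 (\<lambda>z. F z c)" and u: "class_C 2 u"
  defines "X \<equiv> \<lambda>c z. F z c"
  assumes first: "lie_deriv (X a) u p = 0" "lie_deriv (X b) u p = 0"
    and second: "lie_deriv (X a) (lie_deriv (X a) u) p + 2 * lie_deriv (X a) (lie_deriv (X b) u) p
      + lie_deriv (X b) (lie_deriv (X b) u) p < 0"
  obtains C r where "0 < C" "0 < r"
    "\<And>x. norm (x - p) \<le> r \<Longrightarrow> \<exists>t h y. solution_on F (switch t a b) x (ereal h) y \<and>
      0 \<le> t \<and> 2 * t < h \<and> 2 * t \<le> C * sqrt (norm (x - p)) \<and> u (y (2 * t)) \<le> u p"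
proof -
  have u2: "class_C (Suc 1) u" using u by (simp only: Suc_1)
  have u1: "class_C (Suc 0) u" using class_C_Suc_imp[OF u2] by simp
  have X: "class_C 1 (X c)" for c using F by (simp add: X_def)
  have LX: "class_C 1 (lie_deriv (X c) u)" for c
    by (rule class_C_lie_deriv[OF u2 X])
  define D where "D c d = lie_deriv (X c) (lie_deriv (X d) u)" for c d
  have D_cont: "isCont (D c d) p" for c d
  proof -
    have "class_C 0 (D c d)"
      unfolding D_def
      by (rule class_C_lie_deriv) (use LX class_C_mono[OF _ X] in \<open>simp_all del: class_C.simps\<close>)
    then show ?thesis by (simp add: continuous_on_eq_continuous_at)
  qed
  define \<kappa> where "\<kappa> = - (D a a p + 2 * D a b p + D b b p)"
  have \<kappa>: "0 < \<kappa>" using second by (simp add: \<kappa>_def D_def)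
  \<comment> \<open>The tolerance counts four times in the second-order coefficient, which leaves \<open>- \<kappa> / 2\<close>.\<close>
  have "\<forall>\<^sub>F z in nhds p. D c d z < D c d p + \<kappa> / 8" for c d
    using D_cont[of c d] \<kappa> by (intro order_tendstoD(2)[of "D c d" "D c d p"])
      (auto simp: isCont_def tendsto_at_iff_tendsto_nhds)
  then have "\<forall>\<^sub>F z in nhds p. D a a z < D a a p + \<kappa> / 8 \<and> D a b z < D a b p + \<kappa> / 8
      \<and> D b b z < D b b p + \<kappa> / 8"
    by (intro eventually_conj)
  then obtain \<epsilon> where \<epsilon>: "0 < \<epsilon>" "\<And>z. dist z p < \<epsilon> \<Longrightarrow> D a a z < D a a p + \<kappa> / 8 \<and> D a b z < D a b p + \<kappa> / 8
      \<and> D b b z < D b b p + \<kappa> / 8"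
    by (auto simp: eventually_nhds_metric)
  define \<rho> where "\<rho> = \<epsilon> / 2"
  have \<rho>: "0 < \<rho>" using \<epsilon> by (simp add: \<rho>_def)
  have near: "D a a z \<le> D a a p + \<kappa> / 8" "D a b z \<le> D a b p + \<kappa> / 8" "D b b z \<le> D b b p + \<kappa> / 8"
    if "z \<in> cball p \<rho>" for z
    using \<epsilon>(2)[of z] \<epsilon>(1) that by (auto simp: \<rho>_def dist_commute)
  define S where "S z = lie_deriv (X a) u z + lie_deriv (X b) u z" for z
  have S0: "S p = 0" using first by (simp add: S_def)
  have "class_C (Suc 0) S"
    using class_C_add[OF LX LX] by (simp add: S_def[abs_def])
  then obtain L1 where L1: "0 < L1" "L1-lipschitz_on (cball p \<rho>) S"
    by (rule class_C_imp_lipschitz_on_cball)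
  obtain L2 where L2: "0 < L2" "L2-lipschitz_on (cball p \<rho>) u"
    using u1 by (rule class_C_imp_lipschitz_on_cball)
  define L where "L = max L1 L2"
  have L: "0 < L" using L1 by (simp add: L_def)
  have lip: "S x \<le> L * norm (x - p)" "u x \<le> u p + L * norm (x - p)" if "x \<in> cball p \<rho>" for x
  proof -
    have p: "p \<in> cball p \<rho>" using \<rho> by simp
    have "L-lipschitz_on (cball p \<rho>) S" "L-lipschitz_on (cball p \<rho>) u"
      using L1 L2 by (auto simp: L_def intro: lipschitz_on_le)
    then show "S x \<le> L * norm (x - p)" "u x \<le> u p + L * norm (x - p)"
      using lipschitz_onD[OF _ that p] S0 by (fastforce simp: dist_norm)+
  qed
  obtain h where h: "0 < h" and sol: "\<And>x t. x \<in> cball p (\<rho> / 2) \<Longrightarrow>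
      \<exists>y. solution_on F (switch t a b) x (ereal h) y \<and> (\<forall>s. 0 \<le> s \<and> s < h \<longrightarrow> y s \<in> cball p \<rho>)"
    by (rule local_switched_solution[where F = F and p = p and a = a and b = b, OF F \<rho>]) (rule that)
  define k where "k = sqrt (8 * L / \<kappa>)"
  have k: "0 < k" "k\<^sup>2 = 8 * L / \<kappa>" using L \<kappa> by (auto simp: k_def)
  define m where "m = min 1 (h / 4)"
  have m: "0 < m" "m \<le> 1" "2 * m < h" using h by (auto simp: m_def)
  \<comment> \<open>For \<open>x\<close> within \<open>r\<close> of \<open>p\<close> the leg length \<open>k * sqrt (norm (x - p))\<close> is at most \<open>m\<close>.\<close>
  define r where "r = min (\<rho> / 2) ((m / k)\<^sup>2)"
  show thesis
  proof (rule that[of "2 * k" r])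
    show "0 < 2 * k" "0 < r" using k m \<rho> by (auto simp: r_def)
    fix x assume x: "norm (x - p) \<le> r"
    define t where "t = k * sqrt (norm (x - p))"
    have "sqrt (norm (x - p)) \<le> m / k"
      using x k m by (intro real_le_lsqrt) (auto simp: r_def)
    then have tm: "t \<le> m" using k by (simp add: t_def field_simps)
    have t: "0 \<le> t" "t \<le> 1" "2 * t < h" using tm m k by (auto simp: t_def)
    have xb: "x \<in> cball p (\<rho> / 2)" "x \<in> cball p \<rho>"
      using x \<rho> by (auto simp: r_def dist_norm norm_minus_commute)
    obtain y where y: "solution_on F (switch t a b) x (ereal h) y"
        and ball: "\<And>s. 0 \<le> s \<Longrightarrow> s < h \<Longrightarrow> y s \<in> cball p \<rho>"
      using sol[OF xb(1)] by blast
    have y0: "y 0 = x" using y by (simp add: solution_on_def)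
    have "continuous_on {0..2 * t} y"
      by (rule continuous_on_subset[of "{s. 0 \<le> s \<and> ereal s < ereal h}"])
        (use y t in \<open>auto simp: solution_on_def\<close>)
    moreover have "(y has_vector_derivative X a (y s)) (at s)" if "0 < s" "s < t" for s
    proof -
      have "\<forall>\<^sub>F r in nhds s. switch t a b r = switch t a b s"
        using that by (intro eventually_mono[OF eventually_nhds_in_open[of "{..<t}"]])
          (auto simp: switch_def)
      then have "(y has_vector_derivative F (y s) (switch t a b s)) (at s)"
        using y that t by (auto simp: solution_on_def)
      then show ?thesis using that by (simp add: X_def switch_def)
    qed
    moreover have "(y has_vector_derivative X b (y s)) (at s)" if "t < s" "s < 2 * t" for s
    proof -
      have "\<forall>\<^sub>F r in nhds s. switch t a b r = switch t a b s"
        using that by (intro eventually_mono[OF eventually_nhds_in_open[of "{t<..}"]])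
          (auto simp: switch_def)
      then have "(y has_vector_derivative F (y s) (switch t a b s)) (at s)"
        using y that t by (auto simp: solution_on_def)
      then show ?thesis using that by (simp add: X_def switch_def)
    qed
    ultimately have "u (y (2 * t)) \<le> u (y 0) + t * (lie_deriv (X a) u (y 0) + lie_deriv (X b) u (y 0))
        + t\<^sup>2 / 2 * ((D a a p + \<kappa> / 8) + 2 * (D a b p + \<kappa> / 8) + (D b b p + \<kappa> / 8))"
      using near ball t unfolding D_def by (intro two_leg_estimate[OF u X X t(1)]) auto
    also have "\<dots> = u x + t * S x - t\<^sup>2 * \<kappa> / 4"
      by (simp add: y0 S_def \<kappa>_def field_simps)
    also have "t\<^sup>2 * \<kappa> / 4 = 2 * (L * norm (x - p))"
      using k(2) \<kappa> by (simp add: t_def power_mult_distrib)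
    also have "u x + t * S x - 2 * (L * norm (x - p)) \<le> u p"
    proof -
      have "t * S x \<le> t * (L * norm (x - p))"
        using lip(1)[OF xb(2)] t by (intro mult_left_mono)
      also have "\<dots> \<le> L * norm (x - p)"
        using t L by (intro mult_left_le_one_le) auto
      finally show ?thesis using lip(2)[OF xb(2)] by simp
    qed
    finally have "u (y (2 * t)) \<le> u p" .
    then show "\<exists>t h y. solution_on F (switch t a b) x (ereal h) y \<and>
        0 \<le> t \<and> 2 * t < h \<and> 2 * t \<le> 2 * k * sqrt (norm (x - p)) \<and> u (y (2 * t)) \<le> u p"
      using y t by (intro exI[of _ t] exI[of _ h] exI[of _ y]) (auto simp: t_def)
  qed
qed

text \<open>A bound on the hitting times by a modulus that tends to zero at \<open>p\<close> gives attainability, since the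
  points at a distance below \<open>(t / C)\<^sup>2\<close> and \<open>r\<close> from \<open>p\<close> reach the target before the time \<open>t\<close>.\<close>

lemma STLA_of_hitting_times_le:
  fixes F :: "'x::real_normed_vector \<Rightarrow> 'a::real_normed_vector \<Rightarrow> 'x"
  assumes "0 < C" "0 < r"
    and hit: "\<And>x. norm (x - p) \<le> r \<Longrightarrow>
      \<exists>a\<in>controls. \<exists>s\<in>hitting_times F \<T> a x. s \<le> C * sqrt (norm (x - p))"
  shows "STLA F \<T> p"
    and "norm (x - p) \<le> r \<Longrightarrow> min_time F \<T> x \<le> ereal (C * sqrt (norm (x - p)))"
proof -
  show "STLA F \<T> p"
    unfolding STLA_def
  proof (intro allI impI)
    fix t :: real assume t: "0 < t"
    define e where "e = min r ((t / C)\<^sup>2)"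
    have e: "0 < e" using assms t by (simp add: e_def)
    have "ball p e \<subseteq> {x. \<exists>a\<in>controls. \<exists>s\<in>hitting_times F \<T> a x. s < t}"
    proof
      fix x assume "x \<in> ball p e"
      then have x: "norm (x - p) < e" by (simp add: dist_norm norm_minus_commute)
      have "sqrt (norm (x - p)) < t / C"
        using x t assms(1) by (intro real_less_lsqrt) (auto simp: e_def)
      then have "C * sqrt (norm (x - p)) < t"
        using assms(1) by (simp add: field_simps)
      moreover obtain a s where "a \<in> controls" "s \<in> hitting_times F \<T> a x" "s \<le> C * sqrt (norm (x - p))"
        using hit[of x] x by (auto simp: e_def)
      ultimately show "x \<in> {x. \<exists>a\<in>controls. \<exists>s\<in>hitting_times F \<T> a x. s < t}"
        by (auto intro!: bexI[of _ a] bexI[of _ s])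
    qed
    then show "p \<in> interior {x. \<exists>a\<in>controls. \<exists>s\<in>hitting_times F \<T> a x. s < t}"
      using e by (auto simp: mem_interior)
  qed
  assume "norm (x - p) \<le> r"
  from hit[OF this] obtain a s where as: "a \<in> controls" "s \<in> hitting_times F \<T> a x"
      "s \<le> C * sqrt (norm (x - p))"
    by blast
  have "min_time F \<T> x \<le> hitting_time F \<T> a x"
    unfolding min_time_def using as(1) by (rule INF_lower)
  also have "\<dots> \<le> ereal s"
    unfolding hitting_time_def using as(2) by (rule INF_lower)
  also have "\<dots> \<le> ereal (C * sqrt (norm (x - p)))"
    using as(3) by simp
  finally show "min_time F \<T> x \<le> ereal (C * sqrt (norm (x - p)))" .
qed

section \<open>Attainability\<close>

theorem theorem5p2:
  fixes \<sigma>0 :: "real^'n \<Rightarrow> real^'n"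
    and \<sigma> :: "real^'n \<Rightarrow> real^'m^'n"
    and u :: "real^'n \<Rightarrow> real"
    and xbar :: "real^'n"
  assumes "class_C 2 \<sigma>0" and "class_C 2 \<sigma>" and "class_C 3 u"
    and "grad u xbar \<noteq> 0"
    and "grad u xbar \<bullet> \<sigma>0 xbar = 0"
    and "\<forall>i. grad u xbar \<bullet> column i (\<sigma> xbar) = 0"
    and "grad (\<lambda>x. grad u x \<bullet> \<sigma>0 x) xbar \<bullet> \<sigma>0 xbar \<le> 0"
    and "(\<exists>j. lie_bracket \<sigma>0 (\<lambda>x. column j (\<sigma> x)) xbar \<bullet> grad u xbar \<noteq> 0)
         \<or> \<not> pos_semidef (K_mat u \<sigma> xbar)"
  shows "STLA (affine_system \<sigma>0 \<sigma>) {x. u x \<le> u xbar} xbar \<and>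
    (\<exists>C>0. \<exists>r>0. \<forall>x. norm (x - xbar) \<le> r \<longrightarrow>
       min_time (affine_system \<sigma>0 \<sigma>) {x. u x \<le> u xbar} x \<le> ereal (C * sqrt (norm (x - xbar))))"
proof -
  have \<sigma>0: "class_C 1 \<sigma>0" and \<sigma>: "class_C 1 \<sigma>" and u: "class_C 2 u"
    by (rule class_C_mono[OF _ assms(1)] class_C_mono[OF _ assms(2)] class_C_mono[OF _ assms(3)]; simp)+
  let ?F = "affine_system \<sigma>0 \<sigma>"
  let ?\<sigma> = "\<lambda>j x. column j (\<sigma> x)"
  let ?S = "S_mat u \<sigma> xbar"
  define c where "c = lie_deriv \<sigma>0 (lie_deriv \<sigma>0 u) xbar"
  define p where "p = (\<chi> j. lie_deriv \<sigma>0 (lie_deriv (?\<sigma> j) u) xbar)"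
  define q where "q = (\<chi> j. lie_deriv (?\<sigma> j) (lie_deriv \<sigma>0 u) xbar)"
  have \<sigma>j: "class_C 1 (?\<sigma> j)" for j
    by (rule class_C_bounded_linear[OF bounded_linear_column \<sigma>])
  have F: "class_C 1 (\<lambda>z. ?F z a)" for a
    unfolding affine_system_def by (intro class_C_add \<sigma>0 class_C_bounded_linear[OF bounded_linear_mult_vec \<sigma>])
  have first: "lie_deriv (\<lambda>z. ?F z a) u xbar = 0" for a
    using assms(5,6) by (simp add: lie_deriv_affine_system) (simp add: lie_deriv_def)
  have "c \<le> 0"
    using assms(7) by (simp add: c_def lie_deriv_def[abs_def])
  moreover have "p \<noteq> q \<or> (\<exists>a b. a \<bullet> (?S *v a) + b \<bullet> (?S *v b) + 2 * (b \<bullet> (?S *v a)) < 0)"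
    using assms(8)
  proof
    assume "\<exists>j. lie_bracket \<sigma>0 (?\<sigma> j) xbar \<bullet> grad u xbar \<noteq> 0"
    then obtain j where "p $ j - q $ j \<noteq> 0"
      by (auto simp: p_def q_def lie_deriv_commutator[OF u \<sigma>0 \<sigma>j] simp del: right_minus_eq)
    then show ?thesis by auto
  next
    assume "\<not> pos_semidef (K_mat u \<sigma> xbar)"
    then show ?thesis by (rule not_pos_semidef_K_mat) blast
  qed
  ultimately obtain a b where ab: "norm a \<le> 1" "norm b \<le> 1"
    "4 * c + (p + 3 *\<^sub>R q) \<bullet> a + (3 *\<^sub>R p + q) \<bullet> b
      + (a \<bullet> (?S *v a) + b \<bullet> (?S *v b) + 2 * (b \<bullet> (?S *v a))) < 0"
    by (rule exists_negative_value)
  have second: "lie_deriv (\<lambda>z. ?F z a) (lie_deriv (\<lambda>z. ?F z a) u) xbar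
      + 2 * lie_deriv (\<lambda>z. ?F z a) (lie_deriv (\<lambda>z. ?F z b) u) xbar
      + lie_deriv (\<lambda>z. ?F z b) (lie_deriv (\<lambda>z. ?F z b) u) xbar < 0"
    using ab(3)
    by (simp add: second_lie_deriv_affine_system[OF u \<sigma>0 \<sigma>] inner_add_left flip: c_def p_def q_def)
  obtain C r where C: "0 < C" "0 < r"
    and reach: "\<And>x. norm (x - xbar) \<le> r \<Longrightarrow> \<exists>t h y. solution_on ?F (switch t a b) x (ereal h) y \<and>
      0 \<le> t \<and> 2 * t < h \<and> 2 * t \<le> C * sqrt (norm (x - xbar)) \<and> u (y (2 * t)) \<le> u xbar"
    using switching_reaches_sublevel[OF F u first first second] by metis
  have hit: "\<exists>\<alpha>\<in>controls. \<exists>s\<in>hitting_times ?F {x. u x \<le> u xbar} \<alpha> x. s \<le> C * sqrt (norm (x - xbar))"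
    if x: "norm (x - xbar) \<le> r" for x
  proof -
    obtain t h y where y: "solution_on ?F (switch t a b) x (ereal h) y" "0 \<le> t" "2 * t < h"
        "2 * t \<le> C * sqrt (norm (x - xbar))" "u (y (2 * t)) \<le> u xbar"
      using reach[OF x] by blast
    \<comment> \<open>Hitting times refer to maximal solutions, so the local solution has to be extended.\<close>
    obtain \<tau> z where z: "trajectory ?F (switch t a b) x \<tau> z" "ereal h \<le> \<tau>"
        "\<And>s. 0 \<le> s \<Longrightarrow> ereal s < ereal h \<Longrightarrow> z s = y s"
      using solution_on_extends_to_trajectory[OF y(1)] by blast
    have "ereal (2 * t) < \<tau>"
      using y(3) z(2) by (meson less_ereal.simps(1) less_le_trans)
    moreover have "z (2 * t) = y (2 * t)"
      using y(2,3) by (intro z(3)) auto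
    ultimately have "2 * t \<in> hitting_times ?F {x. u x \<le> u xbar} (switch t a b) x"
      using z(1) y(2,5) by (auto simp: hitting_times_def intro!: exI[of _ \<tau>] exI[of _ z])
    with y(4) switch_in_controls[OF ab(1,2)] show ?thesis by blast
  qed
  show ?thesis
    using STLA_of_hitting_times_le[OF C hit] C by blast
qed

end
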